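(* Let $n\ge 1$. There are no bands on $(Q(n),I(n))$, and the algebra $B(n)$ is representation-finite, i.e. it has only finitely many isomorphism classes of indecomposable finite-dimensional modules.
   Context: Let $n\ge 1$ and let $\mathbb{k}$ be an algebraically closed field; $[i,j]$ denotes the integer interval $\{i,\dots,j\}$. The quiver $Q(n)$ has vertices $0,1,\dots,n$ and arrows $\alpha_i\colon i+1\to i$, $\beta_i\colon i\to i+1$ for $i\in[0,n-1]$. Paths are written right to left ($\gamma\delta$ means first $\delta$, then $\gamma$). $I(n)$ is the ideal of the path algebra $\mathbb{k}Q(n)$ generated by $\beta_i\alpha_i-\alpha_{i+1}\beta_{i+1}$, $\alpha_i\alpha_{i+1}$, $\beta_{i+1}\beta_i$ for $i\in[0,n-2]$, together with $\alpha_0\beta_0$. Put $B(n)=\mathbb{k}Q(n)/I(n)$. For each arrow $\gamma$ let $\gamma^*$ be its formal inverse, with $s(\gamma^* )=t(\gamma)$, $t(\gamma^* )=s(\gamma)$, $(\gamma^* )^*=\gamma$; let $Q_1$ be the set of arrows and $Q_1^*$ the set of formal inverses. A walk of length $m\ge 1$ is a sequence $w=\gamma_m\cdots\gamma_1$ with $\gamma_k\in Q_1\cup Q_1^*$ and $s(\gamma_{k+1})=t(\gamma_k)$; its source is $s(w)=s(\gamma_1)$ and its target is $t(w)=t(\gamma_m)$. There is also a trivial walk $\epsilon_i$ of length $0$ at each vertex $i$. The walk is a path if all $\gamma_k\in Q_1$. It is reduced if it has length $0$ or $\gamma_{k+1}\ne\gamma_k^*$ for all $k$. Put $w^*=\gamma_1^*\cdots\gamma_m^*$.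 A walk $w$ contains a non-trivial path $p$ if $p$ or $p^*$ is a consecutive subword of $w$. A string on $(Q(n),I(n))$ is a reduced walk containing no non-trivial path that is a monomial appearing as a summand of one of the listed generators of $I(n)$. A cycle is a walk of positive length with $s(w)=t(w)$. A reduced cycle is a cycle $w=\gamma_m\cdots\gamma_1$ with $\gamma_k\ne\gamma_{k+1}^*$, indices taken modulo $m$. For a reduced cycle $w$, $w^h$ is the concatenation of $w$ with itself $h$ times. A band on $(Q(n),I(n))$ is a reduced cycle $w$ such that $w^h$ is a string for every $h\ge 1$ and such that there is no string $u$ of length strictly less than that of $w$ with $u^k=w$ for some $k>1$. *)

theory Defs
  imports
    "HOL-Computational_Algebra.Polynomial"
    "HOL-Library.Poly_Mapping"
    "HOL-Library.Sublist"
    "HOL-Algebra.Module"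
    "HOL-Algebra.QuotRing"
begin

section \<open>The quiver \<open>Q(n)\<close> and its walks\<close>

text \<open>
  \<open>Alpha i\<close> is the arrow from \<open>i + 1\<close> to \<open>i\<close> and \<open>Beta i\<close> the arrow from \<open>i\<close> to \<open>i + 1\<close>;
  the vertices of \<open>Q(n)\<close> are the natural numbers \<open>0, \<dots>, n\<close>.
\<close>

datatype arrow = Alpha nat | Beta nat

fun arrow_source :: "arrow \<Rightarrow> nat" where
  "arrow_source (Alpha i) = i + 1"
| "arrow_source (Beta i) = i"

fun arrow_target :: "arrow \<Rightarrow> nat" where
  "arrow_target (Alpha i) = i"
| "arrow_target (Beta i) = i + 1"

definition arrows :: "nat \<Rightarrow> arrow set" where
  "arrows n = {Alpha i | i. i < n} \<union> {Beta i | i. i < n}"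

datatype letter = Dir arrow | Inv arrow

fun letter_source :: "letter \<Rightarrow> nat" where
  "letter_source (Dir a) = arrow_source a"
| "letter_source (Inv a) = arrow_target a"

fun letter_target :: "letter \<Rightarrow> nat" where
  "letter_target (Dir a) = arrow_target a"
| "letter_target (Inv a) = arrow_source a"

fun letter_star :: "letter \<Rightarrow> letter" where
  "letter_star (Dir a) = Inv a"
| "letter_star (Inv a) = Dir a"

definition letters :: "nat \<Rightarrow> letter set" where
  "letters n = Dir ` arrows n \<union> Inv ` arrows n"

text \<open>
  A walk is encoded as the pair of its source vertex and its word. Words are listed in the
  order in which they are written, \<open>[\<gamma>\<^sub>m, \<dots>, \<gamma>\<^sub>1]\<close>, so the letter traversed first comes last.
  The trivial walk at \<open>i\<close> is \<open>(i, [])\<close>.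
\<close>

type_synonym walk = "nat \<times> letter list"

definition walk_source :: "walk \<Rightarrow> nat" where
  "walk_source w = fst w"

definition walk_target :: "walk \<Rightarrow> nat" where
  "walk_target w = (if snd w = [] then fst w else letter_target (hd (snd w)))"

definition walks :: "nat \<Rightarrow> walk set" where
  "walks n = {(i, w). i \<le> n \<and> set w \<subseteq> letters n
      \<and> successively (\<lambda>x y. letter_source x = letter_target y) w
      \<and> (w \<noteq> [] \<longrightarrow> letter_source (last w) = i)}"

definition paths :: "nat \<Rightarrow> walk set" where
  "paths n = {w \<in> walks n. set (snd w) \<subseteq> range Dir}"

definition reduced :: "walk \<Rightarrow> bool" where
  "reduced w \<longleftrightarrow> successively (\<lambda>x y. x \<noteq> letter_star y) (snd w)"

definition walk_star :: "walk \<Rightarrow> walk" where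
  "walk_star w = (walk_target w, rev (map letter_star (snd w)))"

definition contains :: "walk \<Rightarrow> walk \<Rightarrow> bool" where
  "contains w p \<longleftrightarrow> sublist (snd p) (snd w) \<or> sublist (snd (walk_star p)) (snd w)"

text \<open>Only meaningful when the source of the left factor is the target of the right one.\<close>

definition walk_append :: "walk \<Rightarrow> walk \<Rightarrow> walk" where
  "walk_append w v = (fst v, snd w @ snd v)"

definition walk_power :: "walk \<Rightarrow> nat \<Rightarrow> walk" where
  "walk_power w h = (fst w, concat (replicate h (snd w)))"


section \<open>The generators of \<open>I(n)\<close>, strings and bands\<close>

text \<open>
  A pair \<open>(p, q)\<close> of commuting paths stands for the generator \<open>p - q\<close>. The condition
  \<open>i + 2 \<le> n\<close> expresses \<open>i \<in> [0, n - 2]\<close>, an empty range if \<open>n = 1\<close>.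
\<close>

definition commuting_paths :: "nat \<Rightarrow> (walk \<times> walk) set" where
  "commuting_paths n =
     {((i + 1, [Dir (Beta i), Dir (Alpha i)]),
       (i + 1, [Dir (Alpha (i + 1)), Dir (Beta (i + 1))])) | i. i + 2 \<le> n}"

definition zero_paths :: "nat \<Rightarrow> walk set" where
  "zero_paths n =
     {(i + 2, [Dir (Alpha i), Dir (Alpha (i + 1))]) | i. i + 2 \<le> n}
     \<union> {(i, [Dir (Beta (i + 1)), Dir (Beta i)]) | i. i + 2 \<le> n}
     \<union> {(0, [Dir (Alpha 0), Dir (Beta 0)])}"

definition monomials :: "nat \<Rightarrow> walk set" where
  "monomials n = fst ` commuting_paths n \<union> snd ` commuting_paths n \<union> zero_paths n"

definition is_string :: "nat \<Rightarrow> walk \<Rightarrow> bool" where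
  "is_string n w \<longleftrightarrow> w \<in> walks n \<and> reduced w \<and> (\<forall>p \<in> monomials n. \<not> contains w p)"

definition is_cycle :: "nat \<Rightarrow> walk \<Rightarrow> bool" where
  "is_cycle n w \<longleftrightarrow> w \<in> walks n \<and> snd w \<noteq> [] \<and> walk_source w = walk_target w"

definition is_reduced_cycle :: "nat \<Rightarrow> walk \<Rightarrow> bool" where
  "is_reduced_cycle n w \<longleftrightarrow> is_cycle n w \<and>
     (\<forall>k < length (snd w).
        snd w ! k \<noteq> letter_star (snd w ! ((k + 1) mod length (snd w))))"

definition is_band :: "nat \<Rightarrow> walk \<Rightarrow> bool" where
  "is_band n w \<longleftrightarrow> is_reduced_cycle n w
     \<and> (\<forall>h \<ge> 1. is_string n (walk_power w h))
     \<and> \<not> (\<exists>u. is_string n u \<and> length (snd u) < length (snd w) \<and> (\<exists>k > 1. walk_power u k = w))"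


section \<open>The algebra \<open>B(n)\<close>\<close>

definition path_mult ::
    "(walk \<Rightarrow>\<^sub>0 'k::field) \<Rightarrow> (walk \<Rightarrow>\<^sub>0 'k) \<Rightarrow> (walk \<Rightarrow>\<^sub>0 'k)" where
  "path_mult f g = (\<Sum>p \<in> Poly_Mapping.keys f. \<Sum>q \<in> Poly_Mapping.keys g.
     if walk_source p = walk_target q
     then Poly_Mapping.single (walk_append p q) (Poly_Mapping.lookup f p * Poly_Mapping.lookup g q)
     else 0)"

text \<open>The element \<open>c \<cdot> 1\<close> of the path algebra, \<open>1\<close> being the sum of the trivial paths.\<close>

definition path_scalar :: "nat \<Rightarrow> 'k::field \<Rightarrow> (walk \<Rightarrow>\<^sub>0 'k)" where
  "path_scalar n c = (\<Sum>i \<le> n. Poly_Mapping.single (i, []) c)"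

definition path_algebra :: "nat \<Rightarrow> (walk \<Rightarrow>\<^sub>0 'k::field) ring" where
  "path_algebra n =
     \<lparr>carrier = {f. Poly_Mapping.keys f \<subseteq> paths n},
      mult = path_mult, one = path_scalar n 1, zero = 0, add = (+)\<rparr>"

definition generators :: "nat \<Rightarrow> (walk \<Rightarrow>\<^sub>0 'k::field) set" where
  "generators n =
     {Poly_Mapping.single p 1 - Poly_Mapping.single q 1 | p q. (p, q) \<in> commuting_paths n}
     \<union> {Poly_Mapping.single p 1 | p. p \<in> zero_paths n}"

definition I_ideal :: "nat \<Rightarrow> (walk \<Rightarrow>\<^sub>0 'k::field) set" where
  "I_ideal n = genideal (path_algebra n) (generators n)"

definition B_algebra :: "nat \<Rightarrow> (walk \<Rightarrow>\<^sub>0 'k::field) set ring" where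
  "B_algebra n = path_algebra n Quot I_ideal n"

text \<open>
  The \<open>\<k>\<close>-algebra structure of \<open>B(n)\<close> is recorded by its structure map \<open>c \<mapsto> c \<cdot> 1\<close>.
\<close>

definition B_scalar :: "nat \<Rightarrow> 'k::field \<Rightarrow> (walk \<Rightarrow>\<^sub>0 'k) set" where
  "B_scalar n c = I_ideal n +>\<^bsub>path_algebra n\<^esub> path_scalar n c"


lemma path_mult_superset:
  assumes "finite A" "Poly_Mapping.keys f \<subseteq> A" "finite B" "Poly_Mapping.keys g \<subseteq> B"
  shows "path_mult f g = (\<Sum>p \<in> A. \<Sum>q \<in> B.
     if walk_source p = walk_target q
     then Poly_Mapping.single (walk_append p q) (Poly_Mapping.lookup f p * Poly_Mapping.lookup g q)
     else 0)"
proof -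
  have 1: "(\<Sum>q \<in> Poly_Mapping.keys g.
     if walk_source p = walk_target q
     then Poly_Mapping.single (walk_append p q) (Poly_Mapping.lookup f p * Poly_Mapping.lookup g q)
     else 0) = (\<Sum>q \<in> B.
     if walk_source p = walk_target q
     then Poly_Mapping.single (walk_append p q) (Poly_Mapping.lookup f p * Poly_Mapping.lookup g q)
     else 0)" for p
    by (rule sum.mono_neutral_left) (use assms in \<open>auto simp: in_keys_iff\<close>)
  show ?thesis
    unfolding path_mult_def 1
    by (rule sum.mono_neutral_left) (use assms in \<open>auto simp: in_keys_iff intro!: sum.neutral\<close>)
qed

lemma path_mult_add_left: "path_mult (f + g) h = path_mult f h + path_mult g h"
proof -
  let ?A = "Poly_Mapping.keys f \<union> Poly_Mapping.keys g \<union> Poly_Mapping.keys (f + g)"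
  have *: "path_mult x h = (\<Sum>p \<in> ?A. \<Sum>q \<in> Poly_Mapping.keys h.
     if walk_source p = walk_target q
     then Poly_Mapping.single (walk_append p q) (Poly_Mapping.lookup x p * Poly_Mapping.lookup h q)
     else 0)" if "x \<in> {f, g, f + g}" for x
    using that by (intro path_mult_superset) auto
  show ?thesis
    by (subst (1 2 3) *) (auto simp: sum.distrib[symmetric] lookup_add ring_distribs single_add
        intro!: sum.cong)
qed

lemma path_mult_add_right: "path_mult h (f + g) = path_mult h f + path_mult h g"
proof -
  let ?A = "Poly_Mapping.keys f \<union> Poly_Mapping.keys g \<union> Poly_Mapping.keys (f + g)"
  have *: "path_mult h x = (\<Sum>p \<in> Poly_Mapping.keys h. \<Sum>q \<in> ?A.
     if walk_source p = walk_target q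
     then Poly_Mapping.single (walk_append p q) (Poly_Mapping.lookup h p * Poly_Mapping.lookup x q)
     else 0)" if "x \<in> {f, g, f + g}" for x
    using that by (intro path_mult_superset) auto
  show ?thesis
    by (subst (1 2 3) *) (auto simp: sum.distrib[symmetric] lookup_add ring_distribs single_add
        intro!: sum.cong)
qed

lemma path_mult_zero [simp]: "path_mult 0 f = 0" "path_mult f 0 = 0"
  by (simp_all add: path_mult_def)

lemma path_mult_sum_left: "path_mult (sum F A) h = (\<Sum>a \<in> A. path_mult (F a) h)"
  by (induction A rule: infinite_finite_induct) (auto simp: path_mult_add_left)

lemma path_mult_sum_right: "path_mult h (sum F A) = (\<Sum>a \<in> A. path_mult h (F a))"
  by (induction A rule: infinite_finite_induct) (auto simp: path_mult_add_right)

lemma path_mult_single: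
  "path_mult (Poly_Mapping.single p a) (Poly_Mapping.single q b) =
     (if walk_source p = walk_target q then Poly_Mapping.single (walk_append p q) (a * b) else 0)"
  by (cases "a = 0"; cases "b = 0") (auto simp: path_mult_def)

lemma path_sum_singles:
  "f = (\<Sum>p \<in> Poly_Mapping.keys f. Poly_Mapping.single p (Poly_Mapping.lookup f p))"
  by (rule poly_mapping_eqI)
     (auto simp: lookup_sum lookup_single when_def sum.delta in_keys_iff)

lemma walk_append_simps [simp]:
  "walk_source (walk_append p q) = walk_source q"
  "walk_source p = walk_target q \<Longrightarrow> walk_target (walk_append p q) = walk_target p"
  "walk_append (walk_append p q) r = walk_append p (walk_append q r)"
  by (auto simp: walk_source_def walk_target_def walk_append_def)

lemma path_mult_assoc: "path_mult (path_mult f g) h = path_mult f (path_mult g h)"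
proof -
  have *: "path_mult (path_mult (Poly_Mapping.single p a) (Poly_Mapping.single q b))
      (Poly_Mapping.single r c) =
    path_mult (Poly_Mapping.single p a) (path_mult (Poly_Mapping.single q b)
      (Poly_Mapping.single r c))" for p q r and a b c :: 'a
    by (auto simp: path_mult_single mult.assoc)
  show ?thesis
    by (subst (1 2) path_sum_singles[of f], subst (1 2) path_sum_singles[of g],
        subst (1 2) path_sum_singles[of h])
       (simp only: path_mult_sum_left path_mult_sum_right *)
qed

lemma walk_append_in_paths:
  assumes "p \<in> paths n" "q \<in> paths n" "walk_source p = walk_target q"
  shows "walk_append p q \<in> paths n"
  using assms
  by (auto simp: paths_def walks_def walk_append_def walk_source_def walk_target_def
      successively_append_iff split: if_splits)

lemma keys_path_mult:
  assumes "Poly_Mapping.keys f \<subseteq> paths n" "Poly_Mapping.keys g \<subseteq> paths n"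
  shows "Poly_Mapping.keys (path_mult f g) \<subseteq> paths n"
proof
  fix x assume "x \<in> Poly_Mapping.keys (path_mult f g)"
  then obtain p q where pq: "p \<in> Poly_Mapping.keys f" "q \<in> Poly_Mapping.keys g"
    "walk_source p = walk_target q" "x = walk_append p q"
    unfolding path_mult_def
    by (force dest!: subsetD[OF keys_sum] split: if_splits)
  then show "x \<in> paths n"
    using assms walk_append_in_paths by blast
qed

lemma walk_target_le: "w \<in> paths n \<Longrightarrow> walk_target w \<le> n"
  by (auto simp: paths_def walks_def walk_target_def letters_def arrows_def neq_Nil_conv)

lemma walk_source_le: "w \<in> paths n \<Longrightarrow> walk_source w \<le> n"
  by (auto simp: paths_def walks_def walk_source_def)

lemma path_scalar_mult:
  assumes "Poly_Mapping.keys f \<subseteq> paths n"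
  shows "path_mult (path_scalar n 1) f = f" "path_mult f (path_scalar n 1) = f"
proof -
  have 1: "path_mult (path_scalar n 1) (Poly_Mapping.single p c) = Poly_Mapping.single p c"
    if "p \<in> paths n" for p c
    using walk_target_le[OF that]
    by (simp add: path_scalar_def path_mult_sum_left path_mult_single walk_append_def
        walk_source_def if_distrib sum.delta cong: if_cong)
  have 2: "path_mult (Poly_Mapping.single p c) (path_scalar n 1) = Poly_Mapping.single p c"
    if "p \<in> paths n" for p c
    using walk_source_le[OF that]
    by (simp add: path_scalar_def path_mult_sum_right path_mult_single walk_append_def
        walk_target_def walk_source_def if_distrib sum.delta cong: if_cong)
  show "path_mult (path_scalar n 1) f = f"
    using assms
    by (subst (1 2) path_sum_singles[of f], unfold path_mult_sum_right)
      (intro sum.cong refl 1, auto)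
  show "path_mult f (path_scalar n 1) = f"
    using assms
    by (subst (1 2) path_sum_singles[of f], unfold path_mult_sum_left)
      (intro sum.cong refl 2, auto)
qed

lemma keys_path_scalar: "Poly_Mapping.keys (path_scalar n c) \<subseteq> paths n"
proof
  fix x assume "x \<in> Poly_Mapping.keys (path_scalar n c)"
  then obtain i where "i \<le> n" "x = (i, [])"
    unfolding path_scalar_def by (force dest!: subsetD[OF keys_sum] split: if_splits)
  then show "x \<in> paths n"
    by (simp add: paths_def walks_def)
qed

lemma ring_path_algebra: "ring (path_algebra n)"
proof (rule ringI)
  show "abelian_group (path_algebra n)"
  proof (rule abelian_groupI, goal_cases)
    case (1 x y)
    then show ?case
      using Poly_Mapping.keys_add[of x y] by (auto simp: path_algebra_def)
  next
    case (6 x)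
    then show ?case
      by (intro bexI[of _ "- x"]) (auto simp: path_algebra_def)
  qed (auto simp: path_algebra_def add_ac)
  show "monoid (path_algebra n)"
    by (intro monoidI)
      (simp_all add: path_algebra_def path_mult_assoc path_scalar_mult keys_path_mult
        keys_path_scalar)
qed (auto simp: path_algebra_def path_mult_add_left path_mult_add_right)

lemma generators_closed:
  assumes "n \<ge> 1"
  shows "generators n \<subseteq> carrier (path_algebra n :: (walk \<Rightarrow>\<^sub>0 'k::field) ring)"
proof -
  have comm: "p \<in> paths n" "q \<in> paths n" if "(p, q) \<in> commuting_paths n" for p q
    using that by (auto simp: commuting_paths_def paths_def walks_def letters_def arrows_def)
  have zero: "p \<in> paths n" if "p \<in> zero_paths n" for p
    using that assms by (auto simp: zero_paths_def paths_def walks_def letters_def arrows_def)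
  show ?thesis
  proof
    fix f :: "walk \<Rightarrow>\<^sub>0 'k"
    assume "f \<in> generators n"
    then consider p q where "(p, q) \<in> commuting_paths n"
        "f = Poly_Mapping.single p 1 - Poly_Mapping.single q 1"
      | p where "p \<in> zero_paths n" "f = Poly_Mapping.single p 1"
      by (auto simp: generators_def)
    then show "f \<in> carrier (path_algebra n)"
    proof cases
      case 1
      then have "Poly_Mapping.keys f \<subseteq> {p, q}"
        using keys_diff[of "Poly_Mapping.single p (1::'k)" "Poly_Mapping.single q 1"]
        by (simp add: insert_commute)
      then show ?thesis
        using comm[OF 1(1)] by (auto simp: path_algebra_def)
    qed (use zero in \<open>auto simp: path_algebra_def\<close>)
  qed
qed

lemma ring_B_algebra:
  assumes "n \<ge> 1"
  shows "ring (B_algebra n)"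
  unfolding B_algebra_def I_ideal_def
  by (intro ideal.quotient_is_ring ring.genideal_ideal ring_path_algebra generators_closed assms)


section \<open>Modules over a \<open>\<k>\<close>-algebra\<close>

text \<open>
  The library locale \<open>module\<close> requires a commutative ring of scalars; this is its
  counterpart for unital left modules over an arbitrary ring.
\<close>

locale left_module = R?: ring R + M?: abelian_group M for R (structure) and M (structure) +
  assumes smult_closed: "\<lbrakk>a \<in> carrier R; x \<in> carrier M\<rbrakk> \<Longrightarrow> a \<odot>\<^bsub>M\<^esub> x \<in> carrier M"
    and smult_l_distr: "\<lbrakk>a \<in> carrier R; b \<in> carrier R; x \<in> carrier M\<rbrakk> \<Longrightarrow>
      (a \<oplus>\<^bsub>R\<^esub> b) \<odot>\<^bsub>M\<^esub> x = a \<odot>\<^bsub>M\<^esub> x \<oplus>\<^bsub>M\<^esub> b \<odot>\<^bsub>M\<^esub> x"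
    and smult_r_distr: "\<lbrakk>a \<in> carrier R; x \<in> carrier M; y \<in> carrier M\<rbrakk> \<Longrightarrow>
      a \<odot>\<^bsub>M\<^esub> (x \<oplus>\<^bsub>M\<^esub> y) = a \<odot>\<^bsub>M\<^esub> x \<oplus>\<^bsub>M\<^esub> a \<odot>\<^bsub>M\<^esub> y"
    and smult_assoc: "\<lbrakk>a \<in> carrier R; b \<in> carrier R; x \<in> carrier M\<rbrakk> \<Longrightarrow>
      (a \<otimes>\<^bsub>R\<^esub> b) \<odot>\<^bsub>M\<^esub> x = a \<odot>\<^bsub>M\<^esub> (b \<odot>\<^bsub>M\<^esub> x)"
    and smult_one: "x \<in> carrier M \<Longrightarrow> \<one>\<^bsub>R\<^esub> \<odot>\<^bsub>M\<^esub> x = x"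

text \<open>
  A \<open>\<k>\<close>-algebra is given by a ring \<open>R\<close> and its structure map \<open>\<eta> :: 'k \<Rightarrow> 'b\<close>; a scalar \<open>c\<close>
  acts on an \<open>R\<close>-module as \<open>\<eta> c\<close>.
\<close>

definition finite_dimensional :: "('k \<Rightarrow> 'b) \<Rightarrow> ('b, 'v) module \<Rightarrow> bool" where
  "finite_dimensional \<eta> M \<longleftrightarrow> (\<exists>X. finite X \<and> X \<subseteq> carrier M \<and>
     (\<forall>v \<in> carrier M. \<exists>c. v = (\<Oplus>\<^bsub>M\<^esub>x \<in> X. \<eta> (c x) \<odot>\<^bsub>M\<^esub> x)))"

definition indecomposable :: "'b ring \<Rightarrow> ('b, 'v) module \<Rightarrow> bool" where
  "indecomposable R M \<longleftrightarrow> carrier M \<noteq> {\<zero>\<^bsub>M\<^esub>} \<and>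
     (\<forall>U W. submodule U R M \<and> submodule W R M
        \<and> U \<inter> W = {\<zero>\<^bsub>M\<^esub>} \<and> U <+>\<^bsub>M\<^esub> W = carrier M
        \<longrightarrow> U = {\<zero>\<^bsub>M\<^esub>} \<or> W = {\<zero>\<^bsub>M\<^esub>})"

definition module_isomorphic :: "'b ring \<Rightarrow> ('b, 'v) module \<Rightarrow> ('b, 'w) module \<Rightarrow> bool" where
  "module_isomorphic R M N \<longleftrightarrow> (\<exists>f. bij_betw f (carrier M) (carrier N)
     \<and> (\<forall>x \<in> carrier M. \<forall>y \<in> carrier M. f (x \<oplus>\<^bsub>M\<^esub> y) = f x \<oplus>\<^bsub>N\<^esub> f y)
     \<and> (\<forall>a \<in> carrier R. \<forall>x \<in> carrier M. f (a \<odot>\<^bsub>M\<^esub> x) = a \<odot>\<^bsub>N\<^esub> f x))"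

definition fd_indecomposables :: "'b ring \<Rightarrow> ('k \<Rightarrow> 'b) \<Rightarrow> ('b, 'v) module set" where
  "fd_indecomposables R \<eta> =
     {M. left_module R M \<and> finite_dimensional \<eta> M \<and> indecomposable R M}"

text \<open>
  HOL cannot quantify over all modules of all types at once. The type argument \<open>'v\<close> is the
  type from which the underlying sets of the modules are taken, and the assertion is meant
  for every \<open>'v\<close>. Taking \<open>nat \<Rightarrow> 'k\<close> for \<open>'v\<close> already covers every finite-dimensional
  module up to isomorphism.
\<close>

definition representation_finite :: "'v itself \<Rightarrow> 'b ring \<Rightarrow> ('k \<Rightarrow> 'b) \<Rightarrow> bool" where
  "representation_finite TYPE('v) R \<eta> \<longleftrightarrow>
     finite ((fd_indecomposables R \<eta> :: ('b, 'v) module set) //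
       {(M, N). M \<in> fd_indecomposables R \<eta> \<and> N \<in> fd_indecomposables R \<eta>
          \<and> module_isomorphic R M N})"

end

theory Submission
  imports Defs
begin

text \<open>
  Bands. In a closed walk choose a letter whose target is the highest vertex reached. The walk
  must go down again with the next letter, and as it is reduced these two letters form
  \<open>\<alpha>\<^sub>j\<beta>\<^sub>j\<close> or its formal inverse. All the paths \<open>\<alpha>\<^sub>j\<beta>\<^sub>j\<close> with \<open>j < n\<close> occur in the generators of
  \<open>I(n)\<close>, so no closed walk can be repeated inside a string (\<open>no_bands\<close>).

  Representation-finiteness. Instead of listing the indecomposable modules, the proof attaches
  to each of them an element of a finite set that determines it up to isomorphism. The key notion
  is that of a dual system in a module \<open>M\<close> (\<open>dual_system\<close>): vectors \<open>x\<^sub>i\<close> and linear functionals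
  \<open>\<phi>\<^sub>i\<close> with \<open>\<phi>\<^sub>i(x\<^sub>j) = \<delta>\<^sub>i\<^sub>j\<close> such that each trivial path or arrow \<open>\<gamma>\<close> maps each \<open>x\<^sub>i\<close> to some \<open>x\<^sub>j\<close>
  or to \<open>0\<close>, and each \<open>\<phi>\<^sub>i \<circ> \<gamma>\<close> is some \<open>\<phi>\<^sub>j\<close> or \<open>0\<close>. Then \<open>M\<close> is the direct sum of the
  submodules spanned by the \<open>x\<^sub>i\<close> and cut out by \<open>\<phi>\<^sub>i = 0\<close> (\<open>dual_system_splits\<close>). If \<open>M\<close> is
  indecomposable, the second summand vanishes, the \<open>\<phi>\<^sub>i\<close> are coordinates on \<open>M\<close>, and \<open>M\<close> is
  determined by the table telling which \<open>\<phi>\<^sub>i \<circ> \<gamma>\<close> equals which \<open>\<phi>\<^sub>j\<close>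
  (\<open>isomorphic_of_coordinates\<close>). With a bounded number of indices there are finitely many tables.

  So everything rests on finding, in each \<open>M \<noteq> 0\<close>, a dual system with indices in \<open>[0, n + 3]\<close>
  (\<open>dual_system_exists\<close>). If \<open>\<beta>\<^sub>k\<alpha>\<^sub>kx \<noteq> 0\<close> for some \<open>x\<close>, then the component
  of \<open>x\<close> at the vertex \<open>k + 1\<close> generates a copy of the projective module at that vertex; this
  module is also injective, and the dual system is written down from one functional that does
  not vanish on \<open>\<beta>\<^sub>k\<alpha>\<^sub>kx\<close> (\<open>dual_system_projective\<close>). Otherwise the relations make all paths of length two act as zero.
  Then one may regard the vertices as alternately sources and sinks, as for a zigzag quiver of
  type \<open>A\<close>, and build a chain of vectors and functionals from left to right (\<open>chain_exists\<close>).
  Ending the chain at the last vertex \<open>k\<close> with \<open>e\<^sub>kM \<noteq> 0\<close> leaves no condition on its right side.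
\<close>

section \<open>Closed walks turn back at their highest vertex\<close>

lemma letter_source_target:
  "letter_source x = Suc (letter_target x) \<or> letter_target x = Suc (letter_source x)"
  by (cases x; rename_tac a; case_tac a) auto

lemma alpha_beta_in_monomials:
  assumes "j < n"
  shows "(j, [Dir (Alpha j), Dir (Beta j)]) \<in> monomials n"
proof (cases j)
  case 0
  then show ?thesis by (simp add: monomials_def zero_paths_def)
next
  case (Suc i)
  then have "((i + 1, [Dir (Beta i), Dir (Alpha i)]),
      (i + 1, [Dir (Alpha (i + 1)), Dir (Beta (i + 1))])) \<in> commuting_paths n"
    using assms by (auto simp: commuting_paths_def)
  then have "snd ((i + 1, [Dir (Beta i), Dir (Alpha i)]),
      (i + 1, [Dir (Alpha (i + 1)), Dir (Beta (i + 1))])) \<in> snd ` commuting_paths n"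
    by (rule imageI)
  then show ?thesis using Suc by (simp add: monomials_def)
qed

lemma turn_down_not_string:
  assumes "y \<in> letters n" "x \<noteq> letter_star y" "letter_source x = letter_target y"
    "letter_target y = Suc (letter_source y)" "letter_source x = Suc (letter_target x)"
  shows "\<exists>j<n. [x, y] = [Dir (Alpha j), Dir (Beta j)] \<or> [x, y] = [Inv (Beta j), Inv (Alpha j)]"
proof -
  obtain j where "j < n" "y = Dir (Beta j) \<or> y = Inv (Alpha j)"
    using assms(1,4) by (auto simp: letters_def arrows_def)
  moreover have "x = Dir (Alpha (letter_source y)) \<or> x = Inv (Beta (letter_source y))"
    using assms(3-5) by (cases x; rename_tac a; case_tac a) auto
  ultimately show ?thesis using assms(2) by auto
qed

text \<open>
  The cube of a band is used instead of the band itself, so that every letter of the band has a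
  neighbour on both sides.
\<close>

lemma no_bands: "\<not> is_band n w"
proof
  assume band: "is_band n w"
  define ws where "ws = snd w"
  have ne: "ws \<noteq> []"
    using band by (simp add: is_band_def is_reduced_cycle_def is_cycle_def ws_def)
  have "is_string n (walk_power w 3)" using band by (simp add: is_band_def)
  moreover have "snd (walk_power w 3) = ws @ ws @ ws"
    by (simp add: walk_power_def ws_def numeral_3_eq_3)
  ultimately have
    lts: "set ws \<subseteq> letters n" and
    succ: "successively (\<lambda>x y. letter_source x = letter_target y) (ws @ ws @ ws)" and
    red: "successively (\<lambda>x y. x \<noteq> letter_star y) (ws @ ws @ ws)" and
    mono: "\<And>p. p \<in> monomials n \<Longrightarrow> \<not> contains (walk_power w 3) p"
      "\<And>p. contains (walk_power w 3) p \<longleftrightarrow>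
         sublist (snd p) (ws @ ws @ ws) \<or> sublist (snd (walk_star p)) (ws @ ws @ ws)"
    by (auto simp: is_string_def walks_def reduced_def contains_def case_prod_beta)
  have "Max (letter_target ` set ws) \<in> letter_target ` set ws" using ne by simp
  then obtain y where y: "y \<in> set ws" "letter_target y = Max (letter_target ` set ws)" by auto
  have max: "letter_target z \<le> letter_target y" if "z \<in> set ws" for z
    using that y(2) by simp
  obtain a b where ab: "ws = a @ y # b" using y(1) by (meson split_list)
  obtain x p where xp: "ws @ a = p @ [x]"
    using ne by (metis append_is_Nil_conv rev_exhaust)
  obtain z q where zq: "b @ ws = z # q"
    using ne by (metis append_is_Nil_conv neq_Nil_conv)
  have www: "ws @ ws @ ws = p @ [x, y, z] @ q"
  proof -
    have "ws @ ws @ ws = (ws @ a) @ y # (b @ ws)" by (subst (2) ab) simp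
    then show ?thesis by (simp add: xp zq)
  qed
  have "x \<in> set (ws @ a)" "z \<in> set (b @ ws)" unfolding xp zq by auto
  then have in_ws: "x \<in> set ws" "z \<in> set ws" using ab by auto
  have "letter_source x = letter_target y" "letter_source y = letter_target z"
    "x \<noteq> letter_star y"
    using succ red unfolding www by (auto simp: successively_append_iff)
  then have "\<exists>j<n. [x, y] = [Dir (Alpha j), Dir (Beta j)] \<or> [x, y] = [Inv (Beta j), Inv (Alpha j)]"
    using max[OF in_ws(1)] max[OF in_ws(2)] letter_source_target[of x] letter_source_target[of y]
      lts y(1) by (intro turn_down_not_string) auto
  then obtain j where j: "j < n"
    "[x, y] = [Dir (Alpha j), Dir (Beta j)] \<or> [x, y] = [Inv (Beta j), Inv (Alpha j)]" by blast
  have "sublist [x, y] (ws @ ws @ ws)"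
    unfolding www by (metis append.assoc append_Cons append_Nil sublist_appendI)
  then have "contains (walk_power w 3) (j, [Dir (Alpha j), Dir (Beta j)])"
    using j(2) unfolding mono(2) by (auto simp: walk_star_def)
  then show False using mono(1)[OF alpha_beta_in_monomials[OF j(1)]] by blast
qed

section \<open>Extending linear functionals\<close>

text \<open>
  A vector space whose underlying set is the carrier of an abelian group; the carrier of a
  \<open>B(n)\<close>-module with its scalar action is the intended instance.
\<close>

locale kspace = abelian_group M for M (structure) +
  fixes sc :: "'k::field \<Rightarrow> 'v \<Rightarrow> 'v"
  assumes sc_closed [simp, intro]: "x \<in> carrier M \<Longrightarrow> sc c x \<in> carrier M"
    and sc_add_left: "x \<in> carrier M \<Longrightarrow> sc (c + d) x = sc c x \<oplus> sc d x"
    and sc_add_right: "x \<in> carrier M \<Longrightarrow> y \<in> carrier M \<Longrightarrow> sc c (x \<oplus> y) = sc c x \<oplus> sc c y"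
    and sc_mult: "x \<in> carrier M \<Longrightarrow> sc (c * d) x = sc c (sc d x)"
    and sc_one [simp]: "x \<in> carrier M \<Longrightarrow> sc 1 x = x"
begin

lemma sc_zero_left [simp]: "x \<in> carrier M \<Longrightarrow> sc 0 x = \<zero>"
  using sc_add_left[of x 0 0] by (metis add_0 add.r_cancel_one' sc_closed)

lemma sc_zero_right [simp]: "sc c \<zero> = \<zero>"
  using sc_mult[of \<zero> c 0] by simp

lemma sc_minus: "x \<in> carrier M \<Longrightarrow> x \<oplus> sc (-1) x = \<zero>"
  using sc_add_left[of x 1 "-1"] by simp

lemma sc_minus': "x \<in> carrier M \<Longrightarrow> sc (-1) x \<oplus> x = \<zero>"
  using sc_add_left[of x "-1" 1] by simp

lemma add_diff_self: "x \<in> carrier M \<Longrightarrow> y \<in> carrier M \<Longrightarrow> y \<oplus> (x \<oplus> sc (-1) y) = x"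
  by (simp add: a_lcomm sc_minus)

lemma eq_of_diff:
  assumes "x \<in> carrier M" "y \<in> carrier M" "x \<oplus> sc (-1) y = \<zero>"
  shows "x = y"
  using add_diff_self[OF assms(1,2)] assms by simp

definition subsp :: "'v set \<Rightarrow> bool" where
  "subsp U \<longleftrightarrow> U \<subseteq> carrier M \<and> \<zero> \<in> U \<and> (\<forall>x\<in>U. \<forall>y\<in>U. x \<oplus> y \<in> U) \<and> (\<forall>c. \<forall>x\<in>U. sc c x \<in> U)"

definition functional :: "('v \<Rightarrow> 'k) \<Rightarrow> bool" where
  "functional \<phi> \<longleftrightarrow> (\<forall>x\<in>carrier M. \<forall>y\<in>carrier M. \<phi> (x \<oplus> y) = \<phi> x + \<phi> y)
     \<and> (\<forall>c. \<forall>x\<in>carrier M. \<phi> (sc c x) = c * \<phi> x)"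

definition endo :: "('v \<Rightarrow> 'v) \<Rightarrow> bool" where
  "endo f \<longleftrightarrow> f ` carrier M \<subseteq> carrier M
     \<and> (\<forall>x\<in>carrier M. \<forall>y\<in>carrier M. f (x \<oplus> y) = f x \<oplus> f y)
     \<and> (\<forall>c. \<forall>x\<in>carrier M. f (sc c x) = sc c (f x))"

lemma subspD:
  assumes "subsp U"
  shows "x \<in> U \<Longrightarrow> x \<in> carrier M" "\<zero> \<in> U" "x \<in> U \<Longrightarrow> y \<in> U \<Longrightarrow> x \<oplus> y \<in> U"
    "x \<in> U \<Longrightarrow> sc c x \<in> U"
  using assms by (auto simp: subsp_def)

lemma functionalD:
  assumes "functional \<phi>"
  shows "x \<in> carrier M \<Longrightarrow> y \<in> carrier M \<Longrightarrow> \<phi> (x \<oplus> y) = \<phi> x + \<phi> y"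
    "x \<in> carrier M \<Longrightarrow> \<phi> (sc c x) = c * \<phi> x"
  using assms by (auto simp: functional_def)

lemma functional_zero: "functional \<phi> \<Longrightarrow> \<phi> \<zero> = 0"
  using functionalD(2)[of \<phi> \<zero> 0] by simp

lemma endoD:
  assumes "endo f"
  shows "x \<in> carrier M \<Longrightarrow> f x \<in> carrier M"
    "x \<in> carrier M \<Longrightarrow> y \<in> carrier M \<Longrightarrow> f (x \<oplus> y) = f x \<oplus> f y"
    "x \<in> carrier M \<Longrightarrow> f (sc c x) = sc c (f x)"
  using assms by (auto simp: endo_def)

lemma endo_zero: "endo f \<Longrightarrow> f \<zero> = \<zero>"
  using endoD(3)[of f \<zero> 0] endoD(1)[of f \<zero>] by simp

lemma functional_endo: "functional \<phi> \<Longrightarrow> endo f \<Longrightarrow> functional (\<lambda>x. \<phi> (f x))"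
  by (simp add: functional_def endoD)

lemma endo_endo: "endo f \<Longrightarrow> endo g \<Longrightarrow> endo (\<lambda>x. f (g x))"
  by (auto simp: endo_def image_subset_iff)

lemma subsp_carrier: "subsp (carrier M)"
  by (auto simp: subsp_def)

lemma subsp_zero: "subsp {\<zero>}"
  by (auto simp: subsp_def)

lemma subspI:
  assumes "\<And>x. x \<in> U \<Longrightarrow> x \<in> carrier M" "\<zero> \<in> U"
    "\<And>x y. x \<in> U \<Longrightarrow> y \<in> U \<Longrightarrow> x \<oplus> y \<in> U" "\<And>c x. x \<in> U \<Longrightarrow> sc c x \<in> U"
  shows "subsp U"
  using assms by (auto simp: subsp_def)

lemma subsp_image:
  assumes f: "endo f" and U: "subsp U"
  shows "subsp (f ` U)"
proof (rule subspI)
  note f = endoD[OF f] endo_zero[OF f] and U = subspD[OF U]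
  show "x \<in> f ` U \<Longrightarrow> x \<in> carrier M" for x using f U by auto
  show "\<zero> \<in> f ` U" using f(4) U(2) by (metis imageI)
  show "x \<oplus> y \<in> f ` U" if "x \<in> f ` U" "y \<in> f ` U" for x y
    using that f(2) U(1,3) by (smt (verit) image_iff)
  show "sc c x \<in> f ` U" if "x \<in> f ` U" for c x
    using that f(3) U(1,4) by (smt (verit) image_iff)
qed

lemma subsp_preimage:
  assumes f: "endo f" and U: "subsp U" and V: "subsp V"
  shows "subsp {x \<in> V. f x \<in> U}"
  using endoD[OF f] endo_zero[OF f] subspD[OF U] subspD[OF V] by (intro subspI) auto

lemma subsp_sum:
  assumes "subsp U" "subsp V"
  shows "subsp {u \<oplus> v | u v. u \<in> U \<and> v \<in> V}"
  unfolding subsp_def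
proof (intro conjI ballI allI)
  note U = subspD[OF assms(1)] and V = subspD[OF assms(2)]
  let ?S = "{u \<oplus> v | u v. u \<in> U \<and> v \<in> V}"
  show "?S \<subseteq> carrier M" using U(1) V(1) by auto
  have "\<zero> = \<zero> \<oplus> \<zero>" by simp
  then show "\<zero> \<in> ?S" using U(2) V(2) by blast
  fix x assume "x \<in> ?S"
  then obtain u v where x: "x = u \<oplus> v" "u \<in> U" "v \<in> V" by blast
  show "sc c x \<in> ?S" for c
  proof -
    have "sc c x = sc c u \<oplus> sc c v" using x U(1) V(1) by (simp add: sc_add_right)
    then show ?thesis using x U(4) V(4) by blast
  qed
  fix y assume "y \<in> ?S"
  then obtain u' v' where y: "y = u' \<oplus> v'" "u' \<in> U" "v' \<in> V" by blast
  have "x \<oplus> y = (u \<oplus> u') \<oplus> (v \<oplus> v')"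
    using x y U(1) V(1) by (simp add: a_ac)
  then show "x \<oplus> y \<in> ?S" using x y U(3) V(3) by blast
qed

text \<open>
  Partially defined functionals are handled through their graphs, which makes enlarging the
  domain a matter of adding pairs.
\<close>

definition graph :: "('v \<times> 'k) set \<Rightarrow> bool" where
  "graph G \<longleftrightarrow> G \<subseteq> carrier M \<times> UNIV \<and> (\<zero>, 0) \<in> G
     \<and> (\<forall>x c y d. (x, c) \<in> G \<longrightarrow> (y, d) \<in> G \<longrightarrow> (x \<oplus> y, c + d) \<in> G)
     \<and> (\<forall>a x c. (x, c) \<in> G \<longrightarrow> (sc a x, a * c) \<in> G)
     \<and> (\<forall>c. (\<zero>, c) \<in> G \<longrightarrow> c = 0)"

lemma graphD:
  assumes "graph G"
  shows "(x, c) \<in> G \<Longrightarrow> x \<in> carrier M" "(\<zero>, 0) \<in> G"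
    "(x, c) \<in> G \<Longrightarrow> (y, d) \<in> G \<Longrightarrow> (x \<oplus> y, c + d) \<in> G"
    "(x, c) \<in> G \<Longrightarrow> (sc a x, a * c) \<in> G" "(\<zero>, c) \<in> G \<Longrightarrow> c = 0"
  using assms unfolding graph_def by blast+

lemma graph_unique:
  assumes G: "graph G" and "(x, c) \<in> G" "(x, d) \<in> G"
  shows "c = d"
proof -
  have "(x \<oplus> sc (-1) x, c + (-1) * d) \<in> G"
    using assms graphD[OF G] by blast
  then show ?thesis using graphD(1,5)[OF G] assms(2) by (fastforce simp: sc_minus)
qed

lemma scaled_inverse:
  assumes u: "u \<in> carrier M" and x: "x \<in> carrier M" and eq: "u \<oplus> sc a x = \<zero>" and a: "a \<noteq> 0"
  shows "x = sc (-1/a) u"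
proof -
  have "sc (1/a) (u \<oplus> sc a x) = sc (1/a) u \<oplus> x"
    using u x a sc_mult[OF x, of "1/a" a, symmetric] sc_add_right[OF u, of "sc a x" "1/a"]
    by simp
  moreover have "sc (-1) (sc (-1/a) u) = sc (1/a) u"
    using sc_mult[OF u, of "-1" "-1/a", symmetric] by simp
  ultimately have "x \<oplus> sc (-1) (sc (-1/a) u) = \<zero>"
    by (simp only: a_comm[OF x sc_closed[OF u]] eq sc_zero_right)
  then show ?thesis using u x by (simp add: eq_of_diff)
qed

text \<open>
  The enlarged graph stays single-valued because \<open>u + d x = 0\<close> with \<open>d \<noteq> 0\<close> and \<open>u\<close> in the domain
  would put \<open>x\<close> into the domain.
\<close>

lemma graph_extend_one:
  assumes G: "graph G" and x: "x \<in> carrier M" "x \<notin> Domain G"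
  shows "\<exists>G'. graph G' \<and> G \<subseteq> G' \<and> (x, b) \<in> G'"
proof -
  note g = graphD[OF G]
  define G' where "G' = {(u \<oplus> sc d x, c + d * b) | u c d. (u, c) \<in> G}"
  have memI: "(u, c) \<in> G \<Longrightarrow> y = u \<oplus> sc d x \<Longrightarrow> e = c + d * b \<Longrightarrow> (y, e) \<in> G'" for u c d y e
    unfolding G'_def by blast
  have memE: "\<exists>u c d. (u, c) \<in> G \<and> y = u \<oplus> sc d x \<and> e = c + d * b" if "(y, e) \<in> G'" for y e
    using that unfolding G'_def by blast
  have "G \<subseteq> G'"
  proof clarify
    fix u c assume "(u, c) \<in> G"
    then show "(u, c) \<in> G'" using g(1) x by (intro memI[of u c _ 0]) auto
  qed
  moreover have "(x, b) \<in> G'"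
    using g(2) x by (intro memI[of \<zero> 0 _ 1]) auto
  moreover have "graph G'"
    unfolding graph_def
  proof (intro conjI allI impI)
    show "G' \<subseteq> carrier M \<times> UNIV" using g(1) x by (auto simp: G'_def)
    show "(\<zero>, 0) \<in> G'" using g(2) \<open>G \<subseteq> G'\<close> by blast
  next
    fix v c w d assume "(v, c) \<in> G'" "(w, d) \<in> G'"
    then obtain u p a u' p' a' where *: "(u, p) \<in> G" "v = u \<oplus> sc a x" "c = p + a * b"
      "(u', p') \<in> G" "w = u' \<oplus> sc a' x" "d = p' + a' * b"
      using memE by meson
    then have "u \<in> carrier M" "u' \<in> carrier M" using g(1) by auto
    then have "v \<oplus> w = (u \<oplus> u') \<oplus> sc (a + a') x"
      using * x by (simp add: sc_add_left a_ac)
    then show "(v \<oplus> w, c + d) \<in> G'"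
      using g(3)[OF *(1,4)] *(3,6) by (intro memI) (auto simp: algebra_simps)
  next
    fix r v c assume "(v, c) \<in> G'"
    then obtain u p a where *: "(u, p) \<in> G" "v = u \<oplus> sc a x" "c = p + a * b"
      using memE by meson
    then have "sc r v = sc r u \<oplus> sc (r * a) x"
      using x g(1) by (simp add: sc_add_right sc_mult)
    then show "(sc r v, r * c) \<in> G'"
      using g(4)[OF *(1)] *(3) by (intro memI) (auto simp: algebra_simps)
  next
    fix c assume "(\<zero>, c) \<in> G'"
    then obtain u p a where *: "(u, p) \<in> G" "\<zero> = u \<oplus> sc a x" "c = p + a * b"
      using memE by meson
    have u: "u \<in> carrier M" using * g(1) by blast
    have "a = 0"
    proof (rule ccontr)
      assume "a \<noteq> 0"
      then have "x = sc (-1/a) u" using scaled_inverse[OF u x(1) *(2)[symmetric]] by blast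
      then have "(x, -1/a * p) \<in> G" using g(4)[OF *(1), of "-1/a"] by simp
      then show False using x(2) by blast
    qed
    then have "u = \<zero>" using *(2)[symmetric] u x by simp
    then show "c = 0" using \<open>a = 0\<close> * g(5) by simp
  qed
  ultimately show ?thesis by blast
qed

end

text \<open>
  Finite dimension is stated through subspaces rather than linear combinations, because the
  extension of functionals only needs that a domain containing \<open>X\<close> is everything.
\<close>

locale fd_kspace = kspace M sc
  for M :: "('v, 'm) ring_scheme" (structure) and sc :: "'k::field \<Rightarrow> 'v \<Rightarrow> 'v" +
  assumes spanning: "\<exists>X. finite X \<and> X \<subseteq> carrier M \<and> (\<forall>U. subsp U \<and> X \<subseteq> U \<longrightarrow> carrier M \<subseteq> U)"
begin

lemma functional_extends:
  assumes "graph G"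
  shows "\<exists>\<phi>. functional \<phi> \<and> (\<forall>x c. (x, c) \<in> G \<longrightarrow> \<phi> x = c)"
proof -
  obtain X where X: "finite X" "X \<subseteq> carrier M"
    and span: "\<forall>U. subsp U \<and> X \<subseteq> U \<longrightarrow> carrier M \<subseteq> U"
    using spanning by (elim exE conjE)
  have "\<exists>G'. graph G' \<and> G \<subseteq> G' \<and> X \<subseteq> Domain G'"
    using X(1,2)
  proof (induction X rule: finite_induct)
    case empty
    then show ?case using assms by blast
  next
    case (insert x X)
    then obtain G' where "graph G'" "G \<subseteq> G'" "X \<subseteq> Domain G'" by auto
    then show ?case using graph_extend_one[of G' x 0] insert.prems by (cases "x \<in> Domain G'") blast+
  qed
  then obtain G' where G': "graph G'" "G \<subseteq> G'" "X \<subseteq> Domain G'" by blast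
  note g = graphD[OF G'(1)]
  have "subsp (Domain G')"
    by (rule subspI) (use g in blast)+
  then have dom: "x \<in> Domain G'" if "x \<in> carrier M" for x using span[rule_format, of "Domain G'"] G'(3) that by blast
  define \<phi> where "\<phi> x = (THE c. (x, c) \<in> G')" for x
  have \<phi>_eq: "\<phi> x = c" if "(x, c) \<in> G'" for x c
    unfolding \<phi>_def using that graph_unique[OF G'(1)] by blast
  have \<phi>_in: "(x, \<phi> x) \<in> G'" if "x \<in> carrier M" for x
    using dom[OF that] \<phi>_eq by auto
  have "functional \<phi>"
    unfolding functional_def by (auto intro!: \<phi>_eq g(3,4) \<phi>_in)
  then show ?thesis using \<phi>_eq G'(2) by blast
qed

lemma functional_separates:
  assumes U: "subsp U" and x: "x \<in> carrier M" "x \<notin> U"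
  shows "\<exists>\<phi>. functional \<phi> \<and> \<phi> x = 1 \<and> (\<forall>u\<in>U. \<phi> u = 0)"
proof -
  have "graph (U \<times> {0})"
    using subspD[OF U] by (auto simp: graph_def)
  then obtain G where "graph G" "U \<times> {0} \<subseteq> G" "(x, 1) \<in> G"
    using graph_extend_one[of "U \<times> {0}" x 1] x by blast
  then show ?thesis using functional_extends[of G] by blast
qed

text \<open>
  Prescribing \<open>\<phi>\<close> by \<open>\<psi>\<close> along \<open>f\<close> and by \<open>0\<close> on \<open>L\<close> is consistent exactly because \<open>\<psi>\<close>
  vanishes where \<open>f\<close> lands in \<open>L\<close>.
\<close>

lemma functional_factors:
  assumes f: "endo f" and V: "subsp V" and L: "subsp L" and \<psi>: "functional \<psi>"
    and vanish: "\<And>v. v \<in> V \<Longrightarrow> f v \<in> L \<Longrightarrow> \<psi> v = 0"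
  shows "\<exists>\<phi>. functional \<phi> \<and> (\<forall>v\<in>V. \<phi> (f v) = \<psi> v) \<and> (\<forall>l\<in>L. \<phi> l = 0)"
proof -
  note V' = subspD[OF V] and L' = subspD[OF L] and f' = endoD[OF f] and \<psi>' = functionalD[OF \<psi>]
  define G where "G = {(f v \<oplus> l, \<psi> v) | v l. v \<in> V \<and> l \<in> L}"
  have memI: "v \<in> V \<Longrightarrow> l \<in> L \<Longrightarrow> x = f v \<oplus> l \<Longrightarrow> c = \<psi> v \<Longrightarrow> (x, c) \<in> G" for v l x c
    unfolding G_def by blast
  have memE: "\<exists>v l. v \<in> V \<and> l \<in> L \<and> x = f v \<oplus> l \<and> c = \<psi> v" if "(x, c) \<in> G" for x c
    using that unfolding G_def by blast
  have "graph G"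
    unfolding graph_def
  proof (intro conjI allI impI)
    show "G \<subseteq> carrier M \<times> UNIV" using V'(1) L'(1) f'(1) by (auto simp: G_def)
    show "(\<zero>, 0) \<in> G"
      using V'(2) L'(2) endo_zero[OF f] functional_zero[OF \<psi>] by (intro memI[of \<zero> \<zero>]) auto
  next
    fix x c y d assume "(x, c) \<in> G" "(y, d) \<in> G"
    then obtain v l v' l' where *: "v \<in> V" "l \<in> L" "x = f v \<oplus> l" "c = \<psi> v"
      "v' \<in> V" "l' \<in> L" "y = f v' \<oplus> l'" "d = \<psi> v'"
      using memE by meson
    then have "v \<in> carrier M" "l \<in> carrier M" "v' \<in> carrier M" "l' \<in> carrier M"
      using V'(1) L'(1) by auto
    then have "x \<oplus> y = f (v \<oplus> v') \<oplus> (l \<oplus> l')" "c + d = \<psi> (v \<oplus> v')"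
      using * f' \<psi>' by (simp_all add: a_ac)
    then show "(x \<oplus> y, c + d) \<in> G" using memI V'(3) L'(3) * by blast
  next
    fix a x c assume "(x, c) \<in> G"
    then obtain v l where *: "v \<in> V" "l \<in> L" "x = f v \<oplus> l" "c = \<psi> v"
      using memE by meson
    then have "v \<in> carrier M" "l \<in> carrier M" using V'(1) L'(1) by auto
    then have "sc a x = f (sc a v) \<oplus> sc a l" "a * c = \<psi> (sc a v)"
      using * f' \<psi>' by (simp_all add: sc_add_right)
    then show "(sc a x, a * c) \<in> G" using memI V'(4) L'(4) * by blast
  next
    fix c assume "(\<zero>, c) \<in> G"
    then obtain v l where *: "v \<in> V" "l \<in> L" "\<zero> = f v \<oplus> l" "c = \<psi> v"
      using memE by meson
    then have "v \<in> carrier M" "l \<in> carrier M" using V'(1) L'(1) by auto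
    then have "l = sc (-1) (f v)"
      using scaled_inverse[of "f v" l 1] *(3)[symmetric] f'(1) by simp
    then have "f v = sc (-1) l"
      using sc_mult[of "f v" "-1" "-1"] f'(1) \<open>v \<in> carrier M\<close> by simp
    then show "c = 0" using vanish[OF *(1)] L'(4) * by simp
  qed
  then obtain \<phi> where \<phi>: "functional \<phi>" "\<And>x c. (x, c) \<in> G \<Longrightarrow> \<phi> x = c"
    using functional_extends by blast
  have "\<phi> (f v) = \<psi> v" if "v \<in> V" for v
    using that L'(2) V'(1) f'(1) by (intro \<phi>(2) memI[of v \<zero>]) auto
  moreover have "\<phi> l = 0" if "l \<in> L" for l
    using that V'(2) L'(1) endo_zero[OF f] functional_zero[OF \<psi>] by (intro \<phi>(2) memI[of \<zero> l]) auto
  ultimately show ?thesis using \<phi>(1) by blast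
qed

end

section \<open>Representations of the quiver and dual systems\<close>

context fd_kspace begin

definition dual_system :: "('v \<Rightarrow> 'v) set \<Rightarrow> nat set \<Rightarrow> (nat \<Rightarrow> 'v) \<Rightarrow> (nat \<Rightarrow> 'v \<Rightarrow> 'k) \<Rightarrow> bool" where
  "dual_system F I X \<Phi> \<longleftrightarrow> finite I \<and> I \<noteq> {}
     \<and> (\<forall>i\<in>I. X i \<in> carrier M \<and> functional (\<Phi> i))
     \<and> (\<forall>i\<in>I. \<forall>j\<in>I. \<Phi> i (X j) = (if i = j then 1 else 0))
     \<and> (\<forall>f\<in>F. \<forall>i\<in>I. f (X i) \<in> insert \<zero> (X ` I))
     \<and> (\<forall>f\<in>F. \<forall>i\<in>I. (\<forall>v\<in>carrier M. \<Phi> i (f v) = 0)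
          \<or> (\<exists>j\<in>I. \<forall>v\<in>carrier M. \<Phi> i (f v) = \<Phi> j v))"

end

text \<open>
  A \<open>B(n)\<close>-module seen through the actions \<open>E i\<close>, \<open>A i\<close>, \<open>B i\<close> of the trivial path at \<open>i\<close>, of
  \<open>\<alpha>\<^sub>i\<close> and of \<open>\<beta>\<^sub>i\<close>. The families are indexed by all natural numbers and vanish outside the
  quiver, so that most equations hold without conditions on the indices.
\<close>

locale quiver_rep = fd_kspace M sc
  for M :: "('v, 'm) ring_scheme" (structure) and sc :: "'k::field \<Rightarrow> 'v \<Rightarrow> 'v" +
  fixes n :: nat and E A B :: "nat \<Rightarrow> 'v \<Rightarrow> 'v"
  assumes endos: "endo (E i)" "endo (A i)" "endo (B i)"
    and EE: "x \<in> carrier M \<Longrightarrow> E i (E j x) = (if i = j then E j x else \<zero>)"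
    and EA: "x \<in> carrier M \<Longrightarrow> E i (A j x) = (if i = j then A j x else \<zero>)"
    and AE: "x \<in> carrier M \<Longrightarrow> A j (E i x) = (if i = Suc j then A j x else \<zero>)"
    and EB: "x \<in> carrier M \<Longrightarrow> E i (B j x) = (if i = Suc j then B j x else \<zero>)"
    and BE: "x \<in> carrier M \<Longrightarrow> B j (E i x) = (if i = j then B j x else \<zero>)"
    and AA: "x \<in> carrier M \<Longrightarrow> A i (A j x) = \<zero>"
    and BB: "x \<in> carrier M \<Longrightarrow> B i (B j x) = \<zero>"
    and AB_0: "x \<in> carrier M \<Longrightarrow> A 0 (B 0 x) = \<zero>"
    and AB_Suc: "x \<in> carrier M \<Longrightarrow> Suc i < n \<Longrightarrow> A (Suc i) (B (Suc i) x) = B i (A i x)"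
    and beyond: "x \<in> carrier M \<Longrightarrow> n < i \<Longrightarrow> E i x = \<zero>"
      "x \<in> carrier M \<Longrightarrow> n \<le> i \<Longrightarrow> A i x = \<zero>" "x \<in> carrier M \<Longrightarrow> n \<le> i \<Longrightarrow> B i x = \<zero>"
    and complete: "x \<in> carrier M \<Longrightarrow> (\<And>i. E i x = \<zero>) \<Longrightarrow> x = \<zero>"
begin

lemmas in_carrier [simp, intro] = endoD(1)[OF endos(1)] endoD(1)[OF endos(2)] endoD(1)[OF endos(3)]
lemmas op_add = endoD(2)[OF endos(1)] endoD(2)[OF endos(2)] endoD(2)[OF endos(3)]
lemmas op_sc = endoD(3)[OF endos(1)] endoD(3)[OF endos(2)] endoD(3)[OF endos(3)]
lemmas op_zero [simp] = endos[THEN endo_zero]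

lemma AB_distinct: "x \<in> carrier M \<Longrightarrow> i \<noteq> j \<Longrightarrow> A i (B j x) = \<zero>"
  using AE[of "B j x" i "Suc i"] EB[of x "Suc i" j] by simp

lemma BA_distinct: "x \<in> carrier M \<Longrightarrow> i \<noteq> j \<Longrightarrow> B i (A j x) = \<zero>"
  using BE[of "A j x" i i] EA[of x i j] by simp

lemma ABA: "x \<in> carrier M \<Longrightarrow> A i (B i (A i x)) = \<zero>"
  using AB_0[of "A 0 x"] AB_Suc[of "A i x"] beyond(2)[of "B i (A i x)" i]
  by (cases i; cases "i < n") (auto simp: AA)

lemma BAB: "x \<in> carrier M \<Longrightarrow> B i (A i (B i x)) = \<zero>"
  using AB_0[of x] AB_Suc[of x] beyond(3)[of "A i (B i x)" i]
  by (cases i; cases "i < n") (auto simp: BB)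

definition ops :: "('v \<Rightarrow> 'v) set" where
  "ops = range E \<union> range A \<union> range B"

text \<open>
  The component of \<open>x\<close> at the vertex \<open>k + 1\<close>, again called \<open>x\<close>, generates a submodule with
  top \<open>x\<close>, middle \<open>\<alpha>\<^sub>kx\<close> and \<open>\<beta>\<^sub>k\<^sub>+\<^sub>1x\<close>, and socle
  \<open>z = \<beta>\<^sub>k\<alpha>\<^sub>kx = \<alpha>\<^sub>k\<^sub>+\<^sub>1\<beta>\<^sub>k\<^sub>+\<^sub>1x\<close>. It splits off because a functional \<open>\<phi>\<close> with \<open>\<phi>(z) = 1\<close> can be
  pulled back along all paths into the vertex of \<open>z\<close>, which gives a dual copy of the same
  diamond. At the last vertex \<open>k + 1 = n\<close> there is no \<open>\<beta>\<^sub>k\<^sub>+\<^sub>1\<close> and the diamond degenerates to the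
  uniserial module \<open>x, \<alpha>\<^sub>kx, z\<close>, whence the two possible index sets.
\<close>

lemma dual_system_projective:
  assumes x: "x \<in> carrier M" and nz: "B k (A k x) \<noteq> \<zero>"
  shows "\<exists>I X \<Phi>. I \<subseteq> {..n + 3} \<and> dual_system ops I X \<Phi>"
proof -
  define z where "z = B k (A k x)"
  have z: "z \<in> carrier M" using x by (simp add: z_def)
  have kn: "k < n" using nz beyond(2)[OF x] beyond(3)[of "A k x" k] x by (meson in_carrier not_less)
  obtain \<phi> where \<phi>: "functional \<phi>" "\<phi> z = 1"
    using functional_separates[OF subsp_zero z] nz by (auto simp: z_def)
  note \<phi>_simps = functionalD[OF \<phi>(1)] functional_zero[OF \<phi>(1)]
  \<comment> \<open>Subtracting a multiple of \<open>z\<close> makes \<open>\<phi>\<close> vanish at the top vector. Neither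
     \<open>\<alpha>\<close> nor \<open>\<beta>\<close> notices the change, since both annihilate \<open>z\<close>.\<close>
  define x' where "x' = E (Suc k) x \<oplus> sc (- \<phi> (E (Suc k) x)) z"
  have x': "x' \<in> carrier M" using x z by (simp add: x'_def)
  have Ez: "E i z = (if i = Suc k then z else \<zero>)" for i
    using x by (simp add: z_def EB)
  have Az: "A i z = \<zero>" for i
    using x by (cases "i = k") (simp_all add: z_def ABA AB_distinct)
  have Bz: "B i z = \<zero>" for i
    using x by (simp add: z_def BB)
  have Ex': "E i x' = (if i = Suc k then x' else \<zero>)" for i
    using x z by (simp add: x'_def op_add op_sc EE Ez)
  have Ax': "A i x' = (if i = k then A k x else \<zero>)" for i
    using x z by (simp add: x'_def op_add op_sc AE Az)
  have Bx': "B i x' = (if i = Suc k then B (Suc k) x else \<zero>)" for i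
    using x z by (simp add: x'_def op_add op_sc BE Bz)
  have \<phi>x': "\<phi> x' = 0"
    using x z \<phi> by (simp add: x'_def \<phi>_simps)
  have AB: "A i (B (Suc k) x) = (if i = Suc k then z else \<zero>)" if "Suc k < n" for i
    using x that by (cases "i = Suc k") (simp_all add: z_def AB_Suc AB_distinct)
  have BA: "B i (A k x) = (if i = k then z else \<zero>)" for i
    using x by (simp add: z_def BA_distinct)
  define X where "X = (\<lambda>i::nat. if i = 0 then x' else if i = 1 then A k x
    else if i = 2 then B (Suc k) x else z)"
  define \<Phi> where "\<Phi> = (\<lambda>i::nat. if i = 0 then (\<lambda>v. \<phi> (B k (A k v))) else if i = 1 then (\<lambda>v. \<phi> (B k v))
    else if i = 2 then (\<lambda>v. \<phi> (A (Suc k) v)) else (\<lambda>v. \<phi> (E (Suc k) v)))"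
  define I :: "nat set" where "I = (if Suc k < n then {0, 1, 2, 3} else {0, 1, 3})"
  have X: "X 0 = x'" "X 1 = A k x" "X (Suc 0) = A k x" "X 2 = B (Suc k) x" "X 3 = z"
    by (simp_all add: X_def)
  have \<Phi>: "\<Phi> 0 v = \<phi> (B k (A k v))" "\<Phi> 1 v = \<phi> (B k v)" "\<Phi> (Suc 0) v = \<phi> (B k v)"
    "\<Phi> 2 v = \<phi> (A (Suc k) v)" "\<Phi> 3 v = \<phi> (E (Suc k) v)" for v
    by (simp_all add: \<Phi>_def)
  have bi: "\<Phi> i (X j) = (if i = j then 1 else 0)" if "i \<in> I" "j \<in> I" for i j
    using that x x' z \<phi>(2) kn
    by (auto simp: I_def X \<Phi> Ex' Ax' Bx' Ez Az Bz AB BA \<phi>x' \<phi>_simps AA BB EA EB split: if_splits)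
  have fin: "I \<noteq> {}" "finite I" "I \<subseteq> {..n + 3}" by (auto simp: I_def)
  have car: "X i \<in> carrier M" for i
    using x x' z by (simp add: X_def)
  have func: "functional (\<Phi> i)" for i
    unfolding \<Phi>_def using functional_endo[OF \<phi>(1)] endo_endo endos
    by simp
  have clX: "f (X i) \<in> insert \<zero> (X ` I)" if f: "f \<in> ops" and i: "i \<in> I" for f i
  proof -
    have "Suc k < n \<or> B (Suc k) x = \<zero>" using beyond(3)[OF x, of "Suc k"] by (cases "Suc k < n") auto
    then show ?thesis
      using f i x x' z unfolding ops_def I_def
      by (auto simp: X Ex' Ax' Bx' Ez Az Bz AB BA AA BB EA EB split: if_splits)
  qed
  have clE: "(\<forall>v\<in>carrier M. \<Phi> i (E m v) = 0) \<or> (\<exists>j\<in>I. \<forall>v\<in>carrier M. \<Phi> i (E m v) = \<Phi> j v)"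
    if i: "i \<in> I" for i m
  proof (cases "\<forall>v\<in>carrier M. \<Phi> i (E m v) = 0")
    case False
    then have "\<forall>v\<in>carrier M. \<Phi> i (E m v) = \<Phi> i v"
      using i unfolding I_def by (auto simp: \<Phi> EE AE BE \<phi>_simps split: if_splits)
    then show ?thesis using i by blast
  qed simp
  have clA: "(\<forall>v\<in>carrier M. \<Phi> i (A m v) = 0) \<or> (\<exists>j\<in>I. \<forall>v\<in>carrier M. \<Phi> i (A m v) = \<Phi> j v)"
    if i: "i \<in> I" for i m
  proof -
    have *: "\<phi> (A m v) = 0" if "v \<in> carrier M" "\<not> m < n" for v
      using that beyond(2)[of v m] by (simp add: \<phi>_simps)
    have "\<forall>v\<in>carrier M. \<Phi> 3 (A m v) = (if m = Suc k then \<Phi> 2 v else 0)"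
      by (auto simp: \<Phi> EA \<phi>_simps)
    moreover have "\<forall>v\<in>carrier M. \<Phi> 2 (A m v) = 0" "\<forall>v\<in>carrier M. \<Phi> 0 (A m v) = 0"
      by (auto simp: \<Phi> AA \<phi>_simps)
    moreover have "\<forall>v\<in>carrier M. \<Phi> 1 (A m v) = (if m = k then \<Phi> 0 v else 0)"
      by (auto simp: \<Phi> BA_distinct \<phi>_simps)
    moreover have "\<forall>v\<in>carrier M. \<not> Suc k < n \<longrightarrow> \<Phi> 2 v = 0"
      using beyond(2)[of _ "Suc k"] by (auto simp: \<Phi> \<phi>_simps)
    ultimately show ?thesis
      using i unfolding I_def by (cases "m = k"; cases "m = Suc k") (auto split: if_splits)
  qed
  have clB: "(\<forall>v\<in>carrier M. \<Phi> i (B m v) = 0) \<or> (\<exists>j\<in>I. \<forall>v\<in>carrier M. \<Phi> i (B m v) = \<Phi> j v)"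
    if i: "i \<in> I" for i m
  proof -
    have "\<forall>v\<in>carrier M. \<Phi> 3 (B m v) = (if m = k then \<Phi> 1 v else 0)"
      by (auto simp: \<Phi> EB \<phi>_simps)
    moreover have "\<forall>v\<in>carrier M. \<Phi> 1 (B m v) = 0"
      by (auto simp: \<Phi> BB \<phi>_simps)
    moreover have "\<forall>v\<in>carrier M. \<Phi> 0 (B m v) = 0"
      by (cases "m = k") (auto simp: \<Phi> BAB AB_distinct \<phi>_simps)
    moreover have "\<forall>v\<in>carrier M. \<Phi> 2 (B m v) = (if m = Suc k then \<Phi> 0 v else 0)" if "Suc k < n"
      using that by (auto simp: \<Phi> AB_distinct AB_Suc \<phi>_simps)
    ultimately show ?thesis
      using i unfolding I_def by (cases "m = k"; cases "m = Suc k") (auto split: if_splits)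
  qed
  have "dual_system ops I X \<Phi>"
    unfolding dual_system_def
  proof (intro conjI ballI)
    fix f i assume "f \<in> ops" and i: "i \<in> I"
    then consider m where "f = E m" | m where "f = A m" | m where "f = B m"
      by (auto simp: ops_def)
    then show "(\<forall>v\<in>carrier M. \<Phi> i (f v) = 0) \<or> (\<exists>j\<in>I. \<forall>v\<in>carrier M. \<Phi> i (f v) = \<Phi> j v)"
      using clE[OF i] clA[OF i] clB[OF i] by cases (simp_all only:)
  qed (use fin car func bi clX in \<open>simp_all only: not_False_eq_True\<close>)
  then show ?thesis using fin(3) by blast
qed

section \<open>Chains when all paths of length two act as zero\<close>

definition vtx :: "nat \<Rightarrow> 'v set" where
  "vtx k = {x \<in> carrier M. E k x = x}"

lemma subsp_vtx: "subsp (vtx k)"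
  by (rule subspI) (auto simp: vtx_def op_add op_sc)

text \<open>
  The vectors and functionals of a dual system for a string module whose rightmost vertex is
  \<open>k\<close>, with sources and sinks alternating. A source is mapped to its neighbours in the chain,
  and its functional vanishes on the images of all arrows; a sink is annihilated by all arrows,
  and its functional pulls back to those of its neighbours. Vectors and functionals outside \<open>I\<close>
  are set to zero so that the conditions at the left end need no case distinction. At \<open>k\<close>
  nothing is required towards \<open>k + 1\<close>.
\<close>

definition chain :: "(nat \<Rightarrow> bool) \<Rightarrow> nat \<Rightarrow> nat set \<Rightarrow> (nat \<Rightarrow> 'v) \<Rightarrow> (nat \<Rightarrow> 'v \<Rightarrow> 'k) \<Rightarrow> bool" where
  "chain src k I X \<Phi> \<longleftrightarrow> I \<subseteq> {..k} \<and> k \<in> I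
     \<and> (\<forall>i\<in>I. X i \<in> vtx i \<and> functional (\<Phi> i) \<and> (\<forall>v\<in>carrier M. \<Phi> i (E i v) = \<Phi> i v) \<and> \<Phi> i (X i) = 1)
     \<and> (\<forall>i. i \<notin> I \<longrightarrow> X i = \<zero> \<and> \<Phi> i = (\<lambda>_. 0))
     \<and> (\<forall>i\<in>I. src i \<longrightarrow>
          (\<forall>j. \<forall>v\<in>carrier M. \<Phi> i (A j v) = 0 \<and> \<Phi> i (B j v) = 0)
          \<and> (\<forall>j. i = Suc j \<longrightarrow> A j (X i) = X j) \<and> (i < k \<longrightarrow> B i (X i) = X (Suc i)))
     \<and> (\<forall>i\<in>I. \<not> src i \<longrightarrow>
          (\<forall>j. A j (X i) = \<zero> \<and> B j (X i) = \<zero>)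
          \<and> (\<forall>j. i = Suc j \<longrightarrow> (\<forall>v\<in>carrier M. \<Phi> i (B j v) = \<Phi> j v))
          \<and> (i < k \<longrightarrow> (\<forall>v\<in>carrier M. \<Phi> i (A i v) = \<Phi> (Suc i) v)))"

lemma chainI:
  assumes "I \<subseteq> {..k}"
    "k \<in> I"
    "\<And>i. \<lbrakk>i \<in> I\<rbrakk> \<Longrightarrow> X i \<in> vtx i"
    "\<And>i. \<lbrakk>i \<in> I\<rbrakk> \<Longrightarrow> functional (\<Phi> i)"
    "\<And>i v. \<lbrakk>i \<in> I; v \<in> carrier M\<rbrakk> \<Longrightarrow> \<Phi> i (E i v) = \<Phi> i v"
    "\<And>i. \<lbrakk>i \<in> I\<rbrakk> \<Longrightarrow> \<Phi> i (X i) = 1"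
    "\<And>i. \<lbrakk>i \<notin> I\<rbrakk> \<Longrightarrow> X i = \<zero>"
    "\<And>i. \<lbrakk>i \<notin> I\<rbrakk> \<Longrightarrow> \<Phi> i = (\<lambda>_. 0)"
    "\<And>i j v. \<lbrakk>i \<in> I; src i; v \<in> carrier M\<rbrakk> \<Longrightarrow> \<Phi> i (A j v) = 0"
    "\<And>i j v. \<lbrakk>i \<in> I; src i; v \<in> carrier M\<rbrakk> \<Longrightarrow> \<Phi> i (B j v) = 0"
    "\<And>j. \<lbrakk>Suc j \<in> I; src (Suc j)\<rbrakk> \<Longrightarrow> A j (X (Suc j)) = X j"
    "\<And>i. \<lbrakk>i \<in> I; src i; i < k\<rbrakk> \<Longrightarrow> B i (X i) = X (Suc i)"
    "\<And>i j. \<lbrakk>i \<in> I; \<not> src i\<rbrakk> \<Longrightarrow> A j (X i) = \<zero>"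
    "\<And>i j. \<lbrakk>i \<in> I; \<not> src i\<rbrakk> \<Longrightarrow> B j (X i) = \<zero>"
    "\<And>j v. \<lbrakk>Suc j \<in> I; \<not> src (Suc j); v \<in> carrier M\<rbrakk> \<Longrightarrow> \<Phi> (Suc j) (B j v) = \<Phi> j v"
    "\<And>i v. \<lbrakk>i \<in> I; \<not> src i; i < k; v \<in> carrier M\<rbrakk> \<Longrightarrow> \<Phi> i (A i v) = \<Phi> (Suc i) v"
  shows "chain src k I X \<Phi>"
  using assms unfolding chain_def by auto

lemma chainD:
  assumes "chain src k I X \<Phi>"
  shows "I \<subseteq> {..k}"
    "k \<in> I"
    "\<And>i. \<lbrakk>i \<in> I\<rbrakk> \<Longrightarrow> X i \<in> vtx i"
    "\<And>i. \<lbrakk>i \<in> I\<rbrakk> \<Longrightarrow> functional (\<Phi> i)"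
    "\<And>i v. \<lbrakk>i \<in> I; v \<in> carrier M\<rbrakk> \<Longrightarrow> \<Phi> i (E i v) = \<Phi> i v"
    "\<And>i. \<lbrakk>i \<in> I\<rbrakk> \<Longrightarrow> \<Phi> i (X i) = 1"
    "\<And>i. \<lbrakk>i \<notin> I\<rbrakk> \<Longrightarrow> X i = \<zero>"
    "\<And>i. \<lbrakk>i \<notin> I\<rbrakk> \<Longrightarrow> \<Phi> i = (\<lambda>_. 0)"
    "\<And>i j v. \<lbrakk>i \<in> I; src i; v \<in> carrier M\<rbrakk> \<Longrightarrow> \<Phi> i (A j v) = 0"
    "\<And>i j v. \<lbrakk>i \<in> I; src i; v \<in> carrier M\<rbrakk> \<Longrightarrow> \<Phi> i (B j v) = 0"
    "\<And>j. \<lbrakk>Suc j \<in> I; src (Suc j)\<rbrakk> \<Longrightarrow> A j (X (Suc j)) = X j"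
    "\<And>i. \<lbrakk>i \<in> I; src i; i < k\<rbrakk> \<Longrightarrow> B i (X i) = X (Suc i)"
    "\<And>i j. \<lbrakk>i \<in> I; \<not> src i\<rbrakk> \<Longrightarrow> A j (X i) = \<zero>"
    "\<And>i j. \<lbrakk>i \<in> I; \<not> src i\<rbrakk> \<Longrightarrow> B j (X i) = \<zero>"
    "\<And>j v. \<lbrakk>Suc j \<in> I; \<not> src (Suc j); v \<in> carrier M\<rbrakk> \<Longrightarrow> \<Phi> (Suc j) (B j v) = \<Phi> j v"
    "\<And>i v. \<lbrakk>i \<in> I; \<not> src i; i < k; v \<in> carrier M\<rbrakk> \<Longrightarrow> \<Phi> i (A i v) = \<Phi> (Suc i) v"
  using assms unfolding chain_def by auto

lemma chain_single:
  assumes "x \<in> vtx k" "functional \<phi>" "\<And>v. v \<in> carrier M \<Longrightarrow> \<phi> (E k v) = \<phi> v" "\<phi> x = 1"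
    and "\<And>j v. src k \<Longrightarrow> v \<in> carrier M \<Longrightarrow> \<phi> (A j v) = 0 \<and> \<phi> (B j v) = 0"
    and "\<And>j. src k \<Longrightarrow> k = Suc j \<Longrightarrow> A j x = \<zero>"
    and "\<And>j. \<not> src k \<Longrightarrow> A j x = \<zero> \<and> B j x = \<zero>"
    and "\<And>j v. \<not> src k \<Longrightarrow> k = Suc j \<Longrightarrow> v \<in> carrier M \<Longrightarrow> \<phi> (B j v) = 0"
  shows "chain src k {k} ((\<lambda>_. \<zero>)(k := x)) ((\<lambda>_ _. 0)(k := \<phi>))"
  by (rule chainI) (use assms in auto)

lemma chain_step:
  assumes c: "chain src k I X \<Phi>" and alt: "src (Suc k) \<longleftrightarrow> \<not> src k"
    and x: "x \<in> vtx (Suc k)" "functional \<phi>" "\<And>v. v \<in> carrier M \<Longrightarrow> \<phi> (E (Suc k) v) = \<phi> v" "\<phi> x = 1"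
    and s: "\<And>j v. src (Suc k) \<Longrightarrow> v \<in> carrier M \<Longrightarrow> \<phi> (A j v) = 0 \<and> \<phi> (B j v) = 0"
      "src (Suc k) \<Longrightarrow> A k x = X k"
      "\<And>v. src (Suc k) \<Longrightarrow> v \<in> carrier M \<Longrightarrow> \<Phi> k (A k v) = \<phi> v"
    and t: "\<And>j. \<not> src (Suc k) \<Longrightarrow> A j x = \<zero> \<and> B j x = \<zero>"
      "\<not> src (Suc k) \<Longrightarrow> B k (X k) = x"
      "\<And>v. \<not> src (Suc k) \<Longrightarrow> v \<in> carrier M \<Longrightarrow> \<phi> (B k v) = \<Phi> k v"
  shows "chain src (Suc k) (insert (Suc k) I) (X(Suc k := x)) (\<Phi>(Suc k := \<phi>))"
proof -
  note c = chainD[OF c]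
  have I: "i \<le> k" "i \<noteq> Suc k" if "i \<in> I" for i using c(1) that by auto
  have "k \<in> I" using c(2) .
  show ?thesis
  proof (rule chainI, goal_cases)
    case 1
    then show ?case using c(1) by auto
  next
    case 2
    then show ?case by simp
  next
    case (3 i)
    then show ?case using c(3)[of i] x(1) by (cases "i = Suc k") auto
  next
    case (4 i)
    then show ?case using c(4)[of i] x(2) by (cases "i = Suc k") auto
  next
    case (5 i v)
    then show ?case using c(5)[of i v] x(3)[of v] by (cases "i = Suc k") auto
  next
    case (6 i)
    then show ?case using c(6)[of i] x(4) by (cases "i = Suc k") auto
  next
    case (7 i)
    then show ?case using c(7)[of i] by simp
  next
    case (8 i)
    then show ?case using c(8)[of i] by simp
  next
    case (9 i j v)
    then show ?case using c(9)[of i v j] s(1)[of v j] by (cases "i = Suc k") auto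
  next
    case (10 i j v)
    then show ?case using c(10)[of i v j] s(1)[of v j] by (cases "i = Suc k") auto
  next
    case (11 j)
    then show ?case using c(11)[of j] s(2) I[of "Suc j"] by (cases "j = k") auto
  next
    case (12 i)
    then show ?case using c(12)[of i] t(2) alt I[of i] \<open>k \<in> I\<close> by (cases "i = k") auto
  next
    case (13 i j)
    then show ?case using c(13)[of i j] t(1)[of j] by (cases "i = Suc k") auto
  next
    case (14 i j)
    then show ?case using c(14)[of i j] t(1)[of j] by (cases "i = Suc k") auto
  next
    case (15 j v)
    then show ?case using c(15)[of j v] t(3)[of v] I[of "Suc j"] by (cases "j = k") auto
  next
    case (16 i v)
    then show ?case using c(16)[of i v] s(3) alt I[of i] \<open>k \<in> I\<close> by (cases "i = k") auto
  qed
qed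

text \<open>
  Classifying the vectors of \<open>e\<^sub>kM\<close> by the string that can be continued from them to the left
  gives a flag of subspaces, and a dual system appears at any jump of this flag. The flag itself is avoided by proving
  the statement for an arbitrary pair \<open>K \<subset> H\<close>, which the induction transports along the arrow
  joining \<open>k + 1\<close> and \<open>k\<close>. At a sink \<open>H\<close> has to lie in the socle; at a source \<open>K\<close> has to contain
  the images of all arrows, which makes the functional found vanish on them.
\<close>

lemma chain_exists:
  assumes alt: "\<And>i. src (Suc i) \<longleftrightarrow> \<not> src i"
    and BA: "\<And>i x. x \<in> carrier M \<Longrightarrow> B i (A i x) = \<zero>"
    and AB: "\<And>i x. x \<in> carrier M \<Longrightarrow> A i (B i x) = \<zero>"
  shows "\<lbrakk>subsp K; subsp H; K \<subset> H; H \<subseteq> vtx k;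
      \<And>j v. src k \<Longrightarrow> v \<in> carrier M \<Longrightarrow> E k (A j v) \<in> K \<and> E k (B j v) \<in> K;
      \<And>j h. \<not> src k \<Longrightarrow> h \<in> H \<Longrightarrow> A j h = \<zero> \<and> B j h = \<zero>\<rbrakk>
    \<Longrightarrow> \<exists>I X \<Phi>. chain src k I X \<Phi> \<and> X k \<in> H \<and> (\<forall>u\<in>K. \<Phi> k u = 0)"
proof (induction k arbitrary: K H)
  case 0
  then obtain x where x: "x \<in> H" "x \<notin> K" by blast
  then have xv: "x \<in> vtx 0" "x \<in> carrier M" "E 0 x = x" using 0(4) by (auto simp: vtx_def)
  obtain \<phi> where \<phi>: "functional \<phi>" "\<phi> x = 1" "\<And>u. u \<in> K \<Longrightarrow> \<phi> u = 0"
    using functional_separates[OF 0(1) xv(2) x(2)] by blast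
  have E: "E 0 u = u" if "u \<in> K" for u using that 0(3,4) by (auto simp: vtx_def)
  have "chain src 0 {0} ((\<lambda>_. \<zero>)(0 := x)) ((\<lambda>_ _. 0)(0 := \<lambda>v. \<phi> (E 0 v)))"
    by (rule chain_single) (use x xv \<phi> 0(5,6) functional_endo[OF \<phi>(1) endos(1)] in \<open>auto simp: EE\<close>)
  then show ?case using x \<phi>(3) E by force
next
  case (Suc k)
  note K = subspD[OF Suc.prems(1)] and H = subspD[OF Suc.prems(2)]
  have KH: "K \<subseteq> H" using Suc.prems(3) by blast
  have Hv: "x \<in> carrier M" "E (Suc k) x = x" if "x \<in> H" for x using that Suc.prems(4) by (auto simp: vtx_def)
  have AB': "A i (B j x) = \<zero>" and BA': "B i (A j x) = \<zero>" if "x \<in> carrier M" for x i j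
    using AB[OF that] BA[OF that] AB_distinct[OF that] BA_distinct[OF that] by (cases "i = j"; simp)+
  \<comment> \<open>The chain of length one at \<open>k + 1\<close>: possible when some vector of \<open>H\<close> avoids a subspace
     \<open>L\<close> large enough to decouple the functional from the vertex \<open>k\<close>.\<close>
  have single: ?case
    if x: "x \<in> H" "x \<notin> L" "src (Suc k) \<Longrightarrow> A k x = \<zero>" and L: "subsp L" "K \<subseteq> L"
      "\<And>v. \<not> src (Suc k) \<Longrightarrow> v \<in> carrier M \<Longrightarrow> B k v \<in> L" for x L
  proof -
    obtain \<phi> where \<phi>: "functional \<phi>" "\<phi> x = 1" "\<And>u. u \<in> L \<Longrightarrow> \<phi> u = 0"
      using functional_separates[OF L(1) Hv(1)[OF x(1)] x(2)] by blast
    have "chain src (Suc k) {Suc k} ((\<lambda>_. \<zero>)(Suc k := x)) ((\<lambda>_ _. 0)(Suc k := \<lambda>v. \<phi> (E (Suc k) v)))"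
    proof (rule chain_single)
      show "x \<in> vtx (Suc k)" "\<phi> (E (Suc k) x) = 1" using Hv[OF x(1)] \<phi>(2) by (auto simp: vtx_def)
      show "functional (\<lambda>v. \<phi> (E (Suc k) v))" using functional_endo[OF \<phi>(1) endos(1)] .
      show "\<phi> (E (Suc k) (A j v)) = 0 \<and> \<phi> (E (Suc k) (B j v)) = 0"
        if "src (Suc k)" "v \<in> carrier M" for j v
        using Suc.prems(5)[OF that, of j] L(2) \<phi>(3) by auto
      show "\<phi> (E (Suc k) (B j v)) = 0"
        if "\<not> src (Suc k)" "Suc k = Suc j" "v \<in> carrier M" for j v
        using L(3)[OF that(1,3)] \<phi>(3) that by (simp add: EB)
    qed (use x Suc.prems(6) in \<open>auto simp: EE\<close>)
    moreover have "\<phi> (E (Suc k) u) = 0" if "u \<in> K" for u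
      using \<phi>(3)[OF subsetD[OF L(2) that]] Hv(2)[OF subsetD[OF KH that]] by simp
    ultimately show ?thesis using x(1) by force
  qed
  show ?case
  proof (cases "src (Suc k)")
    case False
    then have "src k" using alt by simp
    \<comment> \<open>At a sink the pair is pulled back along \<open>\<beta>\<^sub>k\<close>. If the two preimages differ, a
       chain for them is prolonged by the image of its last vector; otherwise no vector of
       \<open>H - K\<close> is an image modulo \<open>K\<close>, and the chain starts afresh.\<close>
    define K' H' where "K' = {v \<in> vtx k. B k v \<in> K}" and "H' = {v \<in> vtx k. B k v \<in> H}"
    have sub: "subsp K'" "subsp H'" "K' \<subseteq> H'" "H' \<subseteq> vtx k"
      unfolding K'_def H'_def using Suc.prems(1,2) KH endos(3) subsp_vtx subsp_preimage by auto
    show ?thesis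
    proof (cases "K' = H'")
      case True
      obtain x where x: "x \<in> H" "x \<notin> K" using Suc.prems(3) by blast
      define L where "L = {u \<oplus> w | u w. u \<in> K \<and> w \<in> B k ` vtx k}"
      have "subsp L"
        unfolding L_def using Suc.prems(1) subsp_sum subsp_image endos(3) subsp_vtx by blast
      moreover have "x \<notin> L"
      proof
        assume "x \<in> L"
        then obtain u v where uv: "u \<in> K" "v \<in> vtx k" "x = u \<oplus> B k v" unfolding L_def by blast
        then have c: "u \<in> carrier M" "v \<in> carrier M" using K(1) by (auto simp: vtx_def)
        have "sc (-1) u \<oplus> x = B k v"
          using c uv(3) sc_minus'[of u] by (simp flip: a_assoc)
        then have "B k v \<in> H" using H(3,4) x(1) uv(1) KH by (metis subsetD)
        then have "v \<in> K'" using True uv(2) by (simp add: H'_def)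
        then have "B k v \<in> K" by (simp add: K'_def)
        then show False using uv K(3) x(2) by simp
      qed
      moreover have "u \<in> L" if "u \<in> K" for u
      proof -
        have "\<zero> \<in> B k ` vtx k" using subspD(2)[OF subsp_image[OF endos(3) subsp_vtx]] .
        then have "u \<oplus> \<zero> \<in> L" unfolding L_def using that by blast
        then show ?thesis using that K(1) by simp
      qed
      moreover have "B k v \<in> L" if "v \<in> carrier M" for v
      proof -
        have "B k v = \<zero> \<oplus> B k (E k v)" "E k v \<in> vtx k"
          using that by (auto simp: BE EE vtx_def)
        then show ?thesis unfolding L_def using K(2) by blast
      qed
      ultimately show ?thesis using single[of x L] x(1) False by blast
    next
      case ne: False
      have "\<exists>I X \<Phi>. chain src k I X \<Phi> \<and> X k \<in> H' \<and> (\<forall>u\<in>K'. \<Phi> k u = 0)"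
      proof (rule Suc.IH)
        show "E k (A j v) \<in> K' \<and> E k (B j v) \<in> K'" if "v \<in> carrier M" for j v
          using that K(2) by (auto simp: K'_def vtx_def EE BE BA' BB)
      qed (use sub ne \<open>src k\<close> in auto)
      then obtain I X \<Phi> where c: "chain src k I X \<Phi>" "X k \<in> H'" "\<And>u. u \<in> K' \<Longrightarrow> \<Phi> k u = 0" by blast
      note cD = chainD[OF c(1)]
      have "k \<in> I" using cD(2) .
      have "\<exists>\<phi>. functional \<phi> \<and> (\<forall>v\<in>vtx k. \<phi> (B k v) = \<Phi> k v) \<and> (\<forall>u\<in>K. \<phi> u = 0)"
        by (rule functional_factors[OF endos(3) subsp_vtx Suc.prems(1) cD(4)[OF \<open>k \<in> I\<close>]])
          (use c(3) in \<open>simp add: K'_def\<close>)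
      then obtain \<phi> where \<phi>: "functional \<phi>" "\<And>v. v \<in> vtx k \<Longrightarrow> \<phi> (B k v) = \<Phi> k v"
        "\<And>u. u \<in> K \<Longrightarrow> \<phi> u = 0"
        by blast
      have \<phi>B: "\<phi> (B k v) = \<Phi> k v" if "v \<in> carrier M" for v
        using \<phi>(2)[of "E k v"] that cD(5)[OF \<open>k \<in> I\<close>] by (simp add: BE EE vtx_def)
      have Xk: "X k \<in> carrier M" "B k (X k) \<in> H" using c(2) by (auto simp: H'_def vtx_def)
      have "chain src (Suc k) (insert (Suc k) I) (X(Suc k := B k (X k))) (\<Phi>(Suc k := \<lambda>v. \<phi> (E (Suc k) v)))"
      proof (rule chain_step[OF c(1) alt])
        show "functional (\<lambda>v. \<phi> (E (Suc k) v))" using functional_endo[OF \<phi>(1) endos(1)] .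
        show "\<phi> (E (Suc k) (B k (X k))) = 1"
          using Xk \<phi>B cD(6)[OF \<open>k \<in> I\<close>] by (simp add: EB)
        show "\<phi> (E (Suc k) (B k v)) = \<Phi> k v" if "v \<in> carrier M" for v
          using that \<phi>B by (simp add: EB)
      qed (use False Xk in \<open>auto simp: EE EB vtx_def AB' BB\<close>)
      moreover have "\<phi> (E (Suc k) u) = 0" if "u \<in> K" for u
        using \<phi>(3)[OF that] Hv(2)[OF subsetD[OF KH that]] by simp
      ultimately show ?thesis using Xk(2) by force
    qed
  next
    case True
    then have "\<not> src k" using alt by simp
    show ?thesis
    \<comment> \<open>At a source the pair is pushed forward along \<open>\<alpha>\<^sub>k\<close>, which keeps it distinct
       unless the kernel already tells \<open>H\<close> from \<open>K\<close>.\<close>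
    proof (cases "\<exists>x \<in> H - K. A k x = \<zero>")
      case True
      then obtain x where "x \<in> H" "x \<notin> K" "A k x = \<zero>" by blast
      then show ?thesis using single[of x K] Suc.prems(1) \<open>src (Suc k)\<close> by blast
    next
      case False
      have "A k ` K \<noteq> A k ` H"
      proof
        assume eq: "A k ` K = A k ` H"
        obtain x where x: "x \<in> H" "x \<notin> K" using Suc.prems(3) by blast
        then obtain u where u: "u \<in> K" "A k x = A k u" using eq by (metis imageE imageI)
        have c: "x \<in> carrier M" "u \<in> carrier M" using x u K H by auto
        have "A k (x \<oplus> sc (-1) u) = \<zero>"
          using c u(2) by (simp add: op_add op_sc sc_minus)
        moreover have "x \<oplus> sc (-1) u \<in> H"
          using x u KH H(3,4) by (meson subsetD)
        ultimately have "x \<oplus> sc (-1) u \<in> K" using False by blast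
        then have "u \<oplus> (x \<oplus> sc (-1) u) \<in> K" using K(3) u(1) by blast
        then show False using add_diff_self[OF c] x(2) by simp
      qed
      then have "A k ` K \<subset> A k ` H" using KH by blast
      then have "\<exists>I X \<Phi>. chain src k I X \<Phi> \<and> X k \<in> A k ` H \<and> (\<forall>u\<in>A k ` K. \<Phi> k u = 0)"
      proof (rule Suc.IH[rotated 2])
        show "subsp (A k ` K)" "subsp (A k ` H)"
          using subsp_image endos(2) Suc.prems(1,2) by auto
      qed (use Hv \<open>\<not> src k\<close> in \<open>auto simp: vtx_def EA AA BA'\<close>)
      then obtain I X \<Phi> x where c: "chain src k I X \<Phi>" "X k = A k x" "x \<in> H"
        "\<And>u. u \<in> K \<Longrightarrow> \<Phi> k (A k u) = 0" by auto
      note cD = chainD[OF c(1)]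
      have "k \<in> I" using cD(2) .
      have "chain src (Suc k) (insert (Suc k) I) (X(Suc k := x)) (\<Phi>(Suc k := \<lambda>v. \<Phi> k (A k v)))"
      proof (rule chain_step[OF c(1) alt])
        show "functional (\<lambda>v. \<Phi> k (A k v))" using functional_endo[OF cD(4)[OF \<open>k \<in> I\<close>] endos(2)] .
        show "\<Phi> k (A k x) = 1" using cD(6)[OF \<open>k \<in> I\<close>] c(2) by simp
      qed (use True Hv[OF c(3)] c(2) functional_zero[OF cD(4)[OF \<open>k \<in> I\<close>]]
           in \<open>auto simp: vtx_def AE AA AB'\<close>)
      then show ?thesis using c(3,4) by force
    qed
  qed
qed

text \<open>
  If the maps between \<open>k\<close> and \<open>k + 1\<close> vanish, the missing conditions at the right end of a
  chain hold trivially.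
\<close>

lemma dual_system_chain:
  assumes c: "chain src k I X \<Phi>"
    and up: "\<And>v. v \<in> carrier M \<Longrightarrow> B k v = \<zero>" "\<And>v. v \<in> carrier M \<Longrightarrow> A k v = \<zero>"
  shows "dual_system ops I X \<Phi>"
proof -
  note cD = chainD[OF c]
  have X: "X i \<in> carrier M" "E i (X i) = X i" if "i \<in> I" for i
    using cD(3)[OF that] by (auto simp: vtx_def)
  have X0: "X i \<in> insert \<zero> (X ` I)" for i using cD(7)[of i] by (cases "i \<in> I") auto
  have \<Phi>0: "(\<forall>v\<in>carrier M. \<Phi> i v = 0) \<or> (\<exists>j\<in>I. \<forall>v\<in>carrier M. \<Phi> i v = \<Phi> j v)" for i
    using cD(8)[of i] by (cases "i \<in> I") auto
  have z: "\<Phi> i \<zero> = 0" if "i \<in> I" for i using functional_zero[OF cD(4)[OF that]] .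
  have XE: "E m (X i) = (if m = i then X i else \<zero>)" if "i \<in> I" for i m
    using EE[OF X(1)[OF that], of m i] X(2)[OF that] by simp
  have XA: "A m (X i) = (if src i \<and> i = Suc m then X m else \<zero>)" if "i \<in> I" for i m
    using AE[OF X(1)[OF that], of m i] X(2)[OF that] cD(11)[of m] cD(13)[of i m] that by auto
  have XB: "B m (X i) = (if src i \<and> i = m \<and> i < k then X (Suc m) else \<zero>)" if "i \<in> I" for i m
    using BE[OF X(1)[OF that], of m i] X[OF that] cD(12)[of m] cD(14)[of i m] that up(1)[of "X i"] cD(1)
    by (cases "i = m"; cases "i = k") (auto split: if_splits)
  have \<Phi>E: "\<Phi> i (E m v) = (if m = i then \<Phi> i v else 0)" if "i \<in> I" "v \<in> carrier M" for i m v
    using EE[OF that(2), of i m] cD(5)[of i v] cD(5)[of i "E m v"] that z[of i] by auto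
  have \<Phi>A: "\<Phi> i (A m v) = (if \<not> src i \<and> i = m \<and> i < k then \<Phi> (Suc m) v else 0)"
    if "i \<in> I" "v \<in> carrier M" for i m v
    using EA[OF that(2), of i m] cD(5)[of i "A m v"] cD(9)[of i v m] cD(16)[of m v] that z[of i]
      up(2)[of v] cD(1)
    by (cases "i = m"; cases "i = k") auto
  have \<Phi>B: "\<Phi> i (B m v) = (if \<not> src i \<and> i = Suc m then \<Phi> m v else 0)"
    if "i \<in> I" "v \<in> carrier M" for i m v
    using EB[OF that(2), of i m] cD(5)[of i "B m v"] cD(10)[of i v m] cD(15)[of m v] that z[of i]
    by auto
  show ?thesis
    unfolding dual_system_def
  proof (intro conjI ballI)
    show "finite I" using cD(1) finite_subset by blast
    show "I \<noteq> {}" using cD(2) by blast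
    show "\<Phi> i (X j) = (if i = j then 1 else 0)" if "i \<in> I" "j \<in> I" for i j
      using \<Phi>E[OF that(1) X(1)[OF that(2)], of j] X(2)[OF that(2)] cD(6)[OF that(1)] by auto
    fix f i assume "f \<in> ops" and i: "i \<in> I"
    then consider m where "f = E m" | m where "f = A m" | m where "f = B m"
      by (auto simp: ops_def)
    note f = this
    show "f (X i) \<in> insert \<zero> (X ` I)"
      using f X0 i by cases (simp_all only: XE XA XB split: if_splits, simp_all)
    show "(\<forall>v\<in>carrier M. \<Phi> i (f v) = 0) \<or> (\<exists>j\<in>I. \<forall>v\<in>carrier M. \<Phi> i (f v) = \<Phi> j v)"
      using f
    proof cases
      case (1 m)
      then show ?thesis using \<Phi>E[OF i, of _ m] \<Phi>0[of i] by auto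
    next
      case (2 m)
      then show ?thesis using \<Phi>A[OF i, of _ m] \<Phi>0[of "Suc m"] by auto
    next
      case (3 m)
      then show ?thesis using \<Phi>B[OF i, of _ m] \<Phi>0[of m] by auto
    qed
  qed (use X cD(4) in auto)
qed

end

context quiver_rep begin

text \<open>
  In the second case the last vertex \<open>k\<close> carrying a nonzero space is made a source if the arrows
  do not fill that space with their images \<open>R\<close>, and a sink otherwise; in the latter case the
  whole space is in the socle, because paths of length two act as zero.
\<close>

lemma dual_system_exists:
  assumes nz: "carrier M \<noteq> {\<zero>}"
  shows "\<exists>I X \<Phi>. I \<subseteq> {..n + 3} \<and> dual_system ops I X \<Phi>"
proof (cases "\<exists>k. \<exists>x\<in>carrier M. B k (A k x) \<noteq> \<zero>")
  case True
  then show ?thesis using dual_system_projective by blast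
next
  case False
  then have BA0: "B i (A i x) = \<zero>" if "x \<in> carrier M" for i x using that by blast
  have AB0: "A i (B i x) = \<zero>" if "x \<in> carrier M" for i x
  proof (cases i)
    case 0
    then show ?thesis using AB_0 that by simp
  next
    case (Suc j)
    then show ?thesis
      using AB_Suc[OF that, of j] BA0[OF that, of j] beyond(2)[of "B i x" i] that by (cases "i < n") auto
  qed
  have AB: "A i (B j x) = \<zero>" and BA: "B i (A j x) = \<zero>" if "x \<in> carrier M" for x i j
    using AB0[OF that] BA0[OF that] AB_distinct[OF that] BA_distinct[OF that] by (cases "i = j"; simp)+
  define S where "S = {i. vtx i \<noteq> {\<zero>}}"
  have vtx0: "\<zero> \<in> vtx i" for i using subspD(2)[OF subsp_vtx] .
  have "S \<subseteq> {..n}"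
  proof
    fix i assume "i \<in> S"
    then obtain x where x: "x \<in> vtx i" "x \<noteq> \<zero>" using vtx0[of i] unfolding S_def by blast
    then show "i \<in> {..n}" using beyond(1)[of x i] by (cases "i \<le> n") (auto simp: vtx_def)
  qed
  then have "finite S" using finite_subset by blast
  have "S \<noteq> {}"
  proof
    assume "S = {}"
    then have *: "y = \<zero>" if "y \<in> vtx i" for y i using that unfolding S_def by blast
    have "x = \<zero>" if "x \<in> carrier M" for x
    proof (rule complete[OF that])
      show "E i x = \<zero>" for i using *[of "E i x" i] that by (simp add: vtx_def EE)
    qed
    then show False using nz by auto
  qed
  define k where "k = Max S"
  have k: "k \<in> S" "\<And>i. i \<in> S \<Longrightarrow> i \<le> k"
    using \<open>finite S\<close> \<open>S \<noteq> {}\<close> by (auto simp: k_def)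
  have "Suc k \<notin> S" using k(2)[of "Suc k"] by auto
  then have *: "y = \<zero>" if "y \<in> vtx (Suc k)" for y using that unfolding S_def by blast
  have E0: "E (Suc k) v = \<zero>" if "v \<in> carrier M" for v
    using *[of "E (Suc k) v"] that by (auto simp: vtx_def EE)
  have up: "B k v = \<zero>" "A k v = \<zero>" if "v \<in> carrier M" for v
    using E0[of "B k v"] EB[OF that, of "Suc k" k] E0[OF that] AE[OF that, of k "Suc k"] that by auto
  have nz_k: "{\<zero>} \<subset> vtx k" using k(1) vtx0[of k] unfolding S_def by blast
  define R where "R = (case k of 0 \<Rightarrow> {\<zero>} | Suc j \<Rightarrow> B j ` carrier M)"
  have R: "subsp R" "R \<subseteq> vtx k"
    using subsp_zero subsp_image[OF endos(3) subsp_carrier] vtx0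
    by (auto simp: R_def vtx_def EB split: nat.split)
  have EA_R: "E k (A j v) = \<zero>" if "v \<in> carrier M" for j v
    using that up(2) by (auto simp: EA)
  have EB_R: "E k (B j v) \<in> R" if "v \<in> carrier M" for j v
    using that subspD(2)[OF R(1)] by (auto simp: EB R_def)
  have "\<exists>src I X \<Phi>. chain src k I X \<Phi>"
  proof (cases "R = vtx k")
    case True
    let ?src = "\<lambda>i. odd (i + k)"
    have "A j h = \<zero> \<and> B j h = \<zero>" if "h \<in> vtx k" for j h
      using that AB BB unfolding True[symmetric] R_def by (auto split: nat.splits)
    then have "\<exists>I X \<Phi>. chain ?src k I X \<Phi> \<and> X k \<in> vtx k \<and> (\<forall>u\<in>{\<zero>}. \<Phi> k u = 0)"
      using BA0 AB0 subsp_zero subsp_vtx nz_k by (intro chain_exists) auto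
    then show ?thesis by blast
  next
    case False
    let ?src = "\<lambda>i. even (i + k)"
    have "\<exists>I X \<Phi>. chain ?src k I X \<Phi> \<and> X k \<in> vtx k \<and> (\<forall>u\<in>R. \<Phi> k u = 0)"
    proof (rule chain_exists)
      show "E k (A j v) \<in> R \<and> E k (B j v) \<in> R" if "v \<in> carrier M" for j v
        using EA_R[OF that] EB_R[OF that] subspD(2)[OF R(1)] by simp
    qed (use R False BA0 AB0 subsp_vtx in auto)
    then show ?thesis by blast
  qed
  then obtain src I X \<Phi> where c: "chain src k I X \<Phi>" by blast
  have "I \<subseteq> {..n + 3}" using chainD(1)[OF c] k(1) \<open>S \<subseteq> {..n}\<close> by fastforce
  then show ?thesis using dual_system_chain[OF c up] by blast
qed

end

section \<open>Dual systems split off direct summands\<close>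

context kspace begin

lemma endo_sc: "endo (sc a)"
  by (auto simp: endo_def sc_add_right simp flip: sc_mult) (simp add: mult.commute)

lemma functional_finsum:
  assumes "functional \<phi>" "finite J" "\<And>i. i \<in> J \<Longrightarrow> g i \<in> carrier M"
  shows "\<phi> (\<Oplus>i\<in>J. g i) = (\<Sum>i\<in>J. \<phi> (g i))"
  using assms(2,3)
  by (induction J rule: finite_induct)
    (simp_all add: functional_zero[OF assms(1)] functionalD[OF assms(1)] Pi_def finsum_closed)

lemma endo_finsum:
  assumes "endo f" "finite J" "\<And>i. i \<in> J \<Longrightarrow> g i \<in> carrier M"
  shows "f (\<Oplus>i\<in>J. g i) = (\<Oplus>i\<in>J. f (g i))"
  using assms(2,3)
  by (induction J rule: finite_induct)
    (simp_all add: endo_zero[OF assms(1)] endoD[OF assms(1)] Pi_def finsum_closed)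

lemma subsp_finsum:
  assumes U: "subsp U" and "finite J" "\<And>i. i \<in> J \<Longrightarrow> g i \<in> U"
  shows "(\<Oplus>i\<in>J. g i) \<in> U"
  using assms(2,3)
  by (induction J rule: finite_induct) (simp_all add: subspD[OF U] Pi_def)

lemma minus_sc: "x \<in> carrier M \<Longrightarrow> \<ominus> x = sc (-1) x"
  by (rule minus_equality) (auto simp: sc_minus')

lemma subsp_subgroup: "subsp U \<Longrightarrow> subgroup U (add_monoid M)"
  using minus_sc subspD
  by (intro subgroup.intro) (auto simp flip: a_inv_def)

end

context fd_kspace begin

text \<open>
  The projection onto the span of the \<open>x\<^sub>i\<close> along the common kernel \<open>W\<close> of the functionals is
  \<open>m \<mapsto> \<Sum>\<^sub>i \<phi>\<^sub>i(m) x\<^sub>i\<close>. Stability of the span under the operators comes from the vectors,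
  stability of \<open>W\<close> from the functionals.
\<close>

lemma dual_system_splits:
  assumes ds: "dual_system F I X \<Phi>" and "\<forall>f\<in>F. endo f"
  defines "W \<equiv> {m \<in> carrier M. \<forall>i\<in>I. \<Phi> i m = 0}"
  shows "\<exists>S. subsp S \<and> subsp W \<and> (\<forall>f\<in>F. f ` S \<subseteq> S \<and> f ` W \<subseteq> W)
    \<and> S \<inter> W = {\<zero>} \<and> S <+>\<^bsub>M\<^esub> W = carrier M \<and> S \<noteq> {\<zero>}"
proof -
  note F = assms(2)[rule_format]
  have I: "finite I" "I \<noteq> {}"
    and X: "\<And>i. i \<in> I \<Longrightarrow> X i \<in> carrier M" and \<Phi>: "\<And>i. i \<in> I \<Longrightarrow> functional (\<Phi> i)"
    and bi: "\<And>i j. i \<in> I \<Longrightarrow> j \<in> I \<Longrightarrow> \<Phi> i (X j) = (if i = j then 1 else 0)"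
    and clX: "\<And>f i. f \<in> F \<Longrightarrow> i \<in> I \<Longrightarrow> f (X i) \<in> insert \<zero> (X ` I)"
    and cl\<Phi>: "\<And>f i. f \<in> F \<Longrightarrow> i \<in> I \<Longrightarrow> (\<forall>v\<in>carrier M. \<Phi> i (f v) = 0)
          \<or> (\<exists>j\<in>I. \<forall>v\<in>carrier M. \<Phi> i (f v) = \<Phi> j v)"
    using ds unfolding dual_system_def by simp_all
  define proj where "proj m = (\<Oplus>i\<in>I. sc (\<Phi> i m) (X i))" for m
  have proj: "endo proj"
    unfolding endo_def
  proof (intro conjI ballI allI)
    show "proj ` carrier M \<subseteq> carrier M" using X by (auto simp: proj_def intro!: finsum_closed)
    fix x assume x: "x \<in> carrier M"
    show "proj (x \<oplus> y) = proj x \<oplus> proj y" if "y \<in> carrier M" for y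
    proof -
      have "proj (x \<oplus> y) = (\<Oplus>i\<in>I. sc (\<Phi> i x) (X i) \<oplus> sc (\<Phi> i y) (X i))"
        unfolding proj_def using X x that functionalD(1)[OF \<Phi>]
        by (intro finsum_cong') (auto simp: sc_add_left)
      also have "\<dots> = proj x \<oplus> proj y"
        unfolding proj_def using X by (intro finsum_addf) auto
      finally show ?thesis .
    qed
    show "proj (sc a x) = sc a (proj x)" for a
    proof -
      have "proj (sc a x) = (\<Oplus>i\<in>I. sc a (sc (\<Phi> i x) (X i)))"
        unfolding proj_def using X x functionalD(2)[OF \<Phi>]
        by (intro finsum_cong') (auto simp: sc_mult)
      then show ?thesis
        unfolding proj_def using X by (simp add: endo_finsum[OF endo_sc] I(1))
    qed
  qed
  have proj_X: "proj (X j) = X j" if "j \<in> I" for j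
  proof -
    have "proj (X j) = (\<Oplus>i\<in>I. if j = i then X i else \<zero>)"
      unfolding proj_def using X bi that by (intro finsum_cong') auto
    also have "\<dots> = X j" using X I(1) that by (intro add.finprod_singleton) auto
    finally show ?thesis .
  qed
  have \<Phi>_proj: "\<Phi> j (proj m) = \<Phi> j m" if "j \<in> I" "m \<in> carrier M" for j m
  proof -
    have "\<Phi> j (proj m) = (\<Sum>i\<in>I. \<Phi> j (sc (\<Phi> i m) (X i)))"
      unfolding proj_def using X by (intro functional_finsum[OF \<Phi>[OF that(1)] I(1)]) auto
    also have "\<dots> = (\<Sum>i\<in>I. if j = i then \<Phi> i m else 0)"
      using X that bi by (intro sum.cong) (auto simp: functionalD(2)[OF \<Phi>[OF that(1)]])
    also have "\<dots> = \<Phi> j m" using I(1) that by simp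
    finally show ?thesis .
  qed
  have proj_proj: "proj m = proj m'" if "\<And>i. i \<in> I \<Longrightarrow> \<Phi> i m = \<Phi> i m'" for m m'
    unfolding proj_def using that X by (intro finsum_cong') auto
  define S where "S = proj ` carrier M"
  have S: "subsp S" unfolding S_def using subsp_image[OF proj subsp_carrier] .
  have XS: "X i \<in> S" if "i \<in> I" for i
    unfolding S_def using proj_X[OF that] X[OF that] by (metis imageI)
  have W: "subsp W"
    unfolding W_def using functionalD[OF \<Phi>] functional_zero[OF \<Phi>]
    by (intro subspI) auto
  have "f ` S \<subseteq> S" if "f \<in> F" for f
  proof
    fix y assume "y \<in> f ` S"
    then obtain m where m: "m \<in> carrier M" "y = f (proj m)" unfolding S_def by blast
    have "y = (\<Oplus>i\<in>I. f (sc (\<Phi> i m) (X i)))"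
      unfolding m(2) proj_def using X by (intro endo_finsum[OF F[OF that] I(1)]) auto
    moreover have "f (sc (\<Phi> i m) (X i)) \<in> S" if "i \<in> I" for i
      using clX[OF \<open>f \<in> F\<close> that] XS subspD(2,4)[OF S] X[OF that]
      by (auto simp: endoD(3)[OF F[OF \<open>f \<in> F\<close>]])
    ultimately show "y \<in> S" using subsp_finsum[OF S I(1)] by simp
  qed
  moreover have "f ` W \<subseteq> W" if "f \<in> F" for f
  proof
    fix y assume "y \<in> f ` W"
    then obtain m where m: "m \<in> carrier M" "\<And>i. i \<in> I \<Longrightarrow> \<Phi> i m = 0" "y = f m"
      unfolding W_def by auto
    then have "\<Phi> i y = 0" if "i \<in> I" for i
      using cl\<Phi>[OF \<open>f \<in> F\<close> that] by auto
    then show "y \<in> W" using m(1,3) endoD(1)[OF F[OF that]] by (simp add: W_def)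
  qed
  moreover have "S \<inter> W = {\<zero>}"
  proof -
    have "y = \<zero>" if y: "y \<in> S" "y \<in> W" for y
    proof -
      from y(1) obtain m where m: "m \<in> carrier M" "y = proj m" unfolding S_def by (elim imageE)
      have "\<Phi> i m = \<Phi> i \<zero>" if "i \<in> I" for i
        using y(2) that \<Phi>_proj[OF that m(1)] functional_zero[OF \<Phi>[OF that]] by (simp add: W_def m(2))
      then have "proj m = proj \<zero>" by (rule proj_proj)
      then show ?thesis using m(2) endo_zero[OF proj] by simp
    qed
    then have "S \<inter> W \<subseteq> {\<zero>}" by (simp only: subset_iff Int_iff singleton_iff) iprover
    then show ?thesis using subspD(2)[OF S] subspD(2)[OF W] by auto
  qed
  moreover have "S <+>\<^bsub>M\<^esub> W = carrier M"
  proof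
    show "S <+>\<^bsub>M\<^esub> W \<subseteq> carrier M"
      using subspD(1)[OF S] subspD(1)[OF W] by (auto simp: set_add_def')
    show "carrier M \<subseteq> S <+>\<^bsub>M\<^esub> W"
    proof
      fix m assume m: "m \<in> carrier M"
      let ?w = "m \<oplus> sc (-1) (proj m)"
      have pm: "proj m \<in> carrier M" using endoD(1)[OF proj m] .
      have "?w \<in> W"
        using m pm \<Phi>_proj functionalD[OF \<Phi>] by (auto simp: W_def)
      moreover have "m = proj m \<oplus> ?w" using add_diff_self[OF m pm] by simp
      moreover have "proj m \<in> S" using m by (simp add: S_def)
      ultimately show "m \<in> S <+>\<^bsub>M\<^esub> W" unfolding set_add_def' by blast
    qed
  qed
  moreover have "S \<noteq> {\<zero>}"
  proof
    assume "S = {\<zero>}"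
    obtain i where "i \<in> I" using I(2) by blast
    then have "X i = \<zero>" "\<Phi> i (X i) = 1" using XS \<open>S = {\<zero>}\<close> bi by auto
    then show False using functional_zero[OF \<Phi>[OF \<open>i \<in> I\<close>]] by simp
  qed
  ultimately show ?thesis using S W by blast
qed

lemma dual_system_values:
  assumes ds: "dual_system F I X \<Phi>"
  shows "\<exists>m\<in>carrier M. \<forall>i\<in>I. \<Phi> i m = c i"
proof -
  have I: "finite I" and X: "\<And>i. i \<in> I \<Longrightarrow> X i \<in> carrier M" and \<Phi>: "\<And>i. i \<in> I \<Longrightarrow> functional (\<Phi> i)"
    and bi: "\<And>i j. i \<in> I \<Longrightarrow> j \<in> I \<Longrightarrow> \<Phi> i (X j) = (if i = j then 1 else 0)"
    using ds unfolding dual_system_def by auto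
  have "\<Phi> j (\<Oplus>i\<in>I. sc (c i) (X i)) = c j" if "j \<in> I" for j
  proof -
    have "\<Phi> j (\<Oplus>i\<in>I. sc (c i) (X i)) = (\<Sum>i\<in>I. \<Phi> j (sc (c i) (X i)))"
      using X by (intro functional_finsum[OF \<Phi>[OF that(1)] I(1)]) auto
    also have "\<dots> = (\<Sum>i\<in>I. if j = i then c i else 0)"
      using X that bi by (intro sum.cong) (auto simp: functionalD(2)[OF \<Phi>[OF that(1)]])
    also have "\<dots> = c j" using I(1) that by simp
    finally show ?thesis .
  qed
  moreover have "(\<Oplus>i\<in>I. sc (c i) (X i)) \<in> carrier M" using X by (auto intro!: finsum_closed)
  ultimately show ?thesis by blast
qed

end

section \<open>Modules over \<open>B(n)\<close> as representations of the quiver\<close>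

definition arrow_walk :: "arrow \<Rightarrow> walk" where
  "arrow_walk a = (arrow_source a, [Dir a])"

definition gen_paths :: "nat \<Rightarrow> walk set" where
  "gen_paths n = (\<lambda>i. (i, [])) ` {..n} \<union> arrow_walk ` arrows n"

lemma gen_paths_simps [simp]:
  "(i, []) \<in> gen_paths n \<longleftrightarrow> i \<le> n"
  "arrow_walk (Alpha j) \<in> gen_paths n \<longleftrightarrow> j < n"
  "arrow_walk (Beta j) \<in> gen_paths n \<longleftrightarrow> j < n"
  by (auto simp: gen_paths_def arrow_walk_def arrows_def image_iff)

lemma finite_gen_paths: "finite (gen_paths n)"
proof -
  have "arrows n = Alpha ` {..<n} \<union> Beta ` {..<n}" by (auto simp: arrows_def)
  then show ?thesis by (simp add: gen_paths_def)
qed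

lemma gen_paths_subset: "gen_paths n \<subseteq> paths n"
  by (auto simp: gen_paths_def arrow_walk_def arrows_def paths_def walks_def letters_def)

lemma path_algebra_simps [simp]:
  "f \<in> carrier (path_algebra n) \<longleftrightarrow> Poly_Mapping.keys f \<subseteq> paths n"
  "mult (path_algebra n) = path_mult" "one (path_algebra n) = path_scalar n 1"
  "zero (path_algebra n) = 0" "add (path_algebra n) = (+)"
  by (auto simp: path_algebra_def)

lemma walk_trivial [simp]:
  "walk_source (i, []) = i" "walk_target (i, []) = i" "walk_append (i, []) p = p"
  "walk_append p (walk_source p, []) = p"
  by (simp_all add: walk_source_def walk_target_def walk_append_def)

lemma path_scalar_single:
  assumes "p \<in> paths n"
  shows "path_mult (path_scalar n c) (Poly_Mapping.single p d) = Poly_Mapping.single p (c * d)"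
    "path_mult (Poly_Mapping.single p d) (path_scalar n c) = Poly_Mapping.single p (d * c)"
  using walk_target_le[OF assms] walk_source_le[OF assms]
  by (simp_all add: path_scalar_def path_mult_sum_left path_mult_sum_right path_mult_single
      sum.delta cong: if_cong)

lemma path_scalar_add: "path_scalar n (c + d) = path_scalar n c + path_scalar n d"
  by (simp add: path_scalar_def single_add sum.distrib)

lemma path_scalar_mult_scalar: "path_mult (path_scalar n c) (path_scalar n d) = path_scalar n (c * d)"
proof -
  have "path_mult (path_scalar n c) (path_scalar n d)
      = (\<Sum>i\<le>n. path_mult (path_scalar n c) (Poly_Mapping.single (i, []) d))"
    by (simp only: path_scalar_def[of n d] path_mult_sum_right)
  also have "\<dots> = (\<Sum>i\<le>n. Poly_Mapping.single (i, []) (c * d))"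
    using gen_paths_subset[of n] by (intro sum.cong refl path_scalar_single) auto
  finally show ?thesis by (simp add: path_scalar_def)
qed

text \<open>
  The path algebra is generated by the scalars, the trivial paths and the arrows. All
  compatibilities with the action of \<open>B(n)\<close> below are checked on these generators only.
\<close>

lemma path_algebra_induct [consumes 1, case_names scalar gen add mult]:
  fixes f :: "walk \<Rightarrow>\<^sub>0 'k::field"
  assumes f: "f \<in> carrier (path_algebra n)"
    and scalar: "\<And>c. P (path_scalar n c)"
    and gen: "\<And>p. p \<in> gen_paths n \<Longrightarrow> P (Poly_Mapping.single p 1)"
    and add: "\<And>f g. \<lbrakk>f \<in> carrier (path_algebra n); g \<in> carrier (path_algebra n); P f; P g\<rbrakk> \<Longrightarrow> P (f + g)"
    and mult: "\<And>f g. \<lbrakk>f \<in> carrier (path_algebra n); g \<in> carrier (path_algebra n); P f; P g\<rbrakk> \<Longrightarrow> P (path_mult f g)"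
  shows "P f"
proof -
  have path: "P (Poly_Mapping.single (i, w) 1)" if "(i, w) \<in> paths n" for i w
    using that
  proof (induction w)
    case Nil
    then show ?case by (intro gen) (auto simp: paths_def walks_def)
  next
    case (Cons x w)
    then obtain a where a: "x = Dir a" "a \<in> arrows n" "(i, w) \<in> paths n" "arrow_source a = walk_target (i, w)"
      by (cases w) (auto simp: paths_def walks_def letters_def walk_target_def)
    then have "Poly_Mapping.single (i, x # w) (1::'k)
        = path_mult (Poly_Mapping.single (arrow_walk a) 1) (Poly_Mapping.single (i, w) 1)"
      by (simp add: path_mult_single arrow_walk_def walk_source_def walk_append_def)
    moreover have "arrow_walk a \<in> gen_paths n" using a(2) by (simp add: gen_paths_def)
    moreover have "P (path_mult (Poly_Mapping.single (arrow_walk a) 1) (Poly_Mapping.single (i, w) 1))"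
      by (rule mult[OF _ _ gen Cons.IH]) (use a(3) calculation(2) gen_paths_subset[of n] in auto)
    ultimately show ?case by simp
  qed
  have single: "P (Poly_Mapping.single p c)" if "p \<in> paths n" for p c
    using mult[OF _ _ scalar[of c] path[of "fst p" "snd p"]] path_scalar_single(1)[OF that, of c 1]
      keys_path_scalar[of n c] that by simp
  have "P (\<Sum>p\<in>J. Poly_Mapping.single p (Poly_Mapping.lookup f p))
      \<and> (\<Sum>p\<in>J. Poly_Mapping.single p (Poly_Mapping.lookup f p)) \<in> carrier (path_algebra n)"
    if "finite J" "J \<subseteq> paths n" for J
    using that
  proof (induction J rule: finite_induct)
    case empty
    then show ?case using scalar[of 0] by (simp add: path_scalar_def)
  next
    case (insert p J)
    then have "Poly_Mapping.single p (Poly_Mapping.lookup f p) \<in> carrier (path_algebra n)" by simp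
    moreover have "x + y \<in> carrier (path_algebra n)"
      if "x \<in> carrier (path_algebra n)" "y \<in> carrier (path_algebra n)" for x y :: "walk \<Rightarrow>\<^sub>0 'k"
      using that Poly_Mapping.keys_add[of x y] by auto
    ultimately show ?case using insert add[OF _ _ single] by simp
  qed
  from this[of "Poly_Mapping.keys f"] show ?thesis
    using f path_sum_singles[of f] by simp
qed

definition cls :: "nat \<Rightarrow> (walk \<Rightarrow>\<^sub>0 'k::field) \<Rightarrow> (walk \<Rightarrow>\<^sub>0 'k) set" where
  "cls n f = I_ideal n +>\<^bsub>path_algebra n\<^esub> f"

locale B_module =
  fixes n :: nat and M :: "((walk \<Rightarrow>\<^sub>0 'k::field) set, 'v) module" (structure)
  assumes n: "n \<ge> 1" and lm: "left_module (B_algebra n) M"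
begin

sublocale left_module "B_algebra n" M by (rule lm)

lemma ideal_I: "ideal (I_ideal n :: (walk \<Rightarrow>\<^sub>0 'k) set) (path_algebra n)"
  unfolding I_ideal_def by (intro ring.genideal_ideal ring_path_algebra generators_closed n)

lemma cls_hom: "cls n \<in> ring_hom (path_algebra n) (B_algebra n :: (walk \<Rightarrow>\<^sub>0 'k) set ring)"
  using ideal.rcos_ring_hom[OF ideal_I] unfolding B_algebra_def cls_def .

lemma cls_carrier [simp, intro]:
  "f \<in> carrier (path_algebra n) \<Longrightarrow> cls n f \<in> carrier (B_algebra n :: (walk \<Rightarrow>\<^sub>0 'k) set ring)"
  using ring_hom_closed[OF cls_hom] .

lemma cls_surj: "carrier (B_algebra n :: (walk \<Rightarrow>\<^sub>0 'k) set ring) = cls n ` carrier (path_algebra n)"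
  by (auto simp: B_algebra_def FactRing_def A_RCOSETS_def' cls_def)

lemma cls_scalar: "B_scalar n c = cls n (path_scalar n c)"
  by (simp add: B_scalar_def cls_def)

lemma cls_generator:
  assumes "g \<in> generators n"
  shows "cls n g = \<zero>\<^bsub>B_algebra n :: (walk \<Rightarrow>\<^sub>0 'k) set ring\<^esub>"
proof -
  have "g \<in> I_ideal n"
    using ring.genideal_self[OF ring_path_algebra generators_closed[OF n]] assms
    unfolding I_ideal_def by blast
  then show ?thesis
    using ideal_I by (simp add: cls_def B_algebra_def FactRing_def ideal.axioms(1)
        additive_subgroup.a_subgroup abelian_subgroup.a_rcos_const ideal_def abelian_subgroupI3 ring.is_abelian_group)
qed

lemma B_algebra_induct [consumes 1, case_names scalar gen add mult]:
  assumes b: "b \<in> carrier (B_algebra n :: (walk \<Rightarrow>\<^sub>0 'k) set ring)"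
    and scalar: "\<And>c. P (B_scalar n c)"
    and gen: "\<And>p. p \<in> gen_paths n \<Longrightarrow> P (cls n (Poly_Mapping.single p 1))"
    and add: "\<And>a b. \<lbrakk>a \<in> carrier (B_algebra n); b \<in> carrier (B_algebra n); P a; P b\<rbrakk> \<Longrightarrow> P (a \<oplus>\<^bsub>B_algebra n\<^esub> b)"
    and mult: "\<And>a b. \<lbrakk>a \<in> carrier (B_algebra n); b \<in> carrier (B_algebra n); P a; P b\<rbrakk> \<Longrightarrow> P (a \<otimes>\<^bsub>B_algebra n\<^esub> b)"
  shows "P b"
proof -
  have "P (cls n f)" if "f \<in> carrier (path_algebra n)" for f
    using that
  proof (induction f rule: path_algebra_induct)
    case (scalar c)
    then show ?case using assms(2) by (simp add: cls_scalar)
  next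
    case (gen p)
    then show ?case using assms(3) by simp
  next
    case (add f g)
    then show ?case using assms(4) ring_hom_add[OF cls_hom add(1,2)] by simp
  next
    case (mult f g)
    then show ?case using assms(5) ring_hom_mult[OF cls_hom mult(1,2)] by simp
  qed
  then show ?thesis using b cls_surj by auto
qed

definition act :: "(walk \<Rightarrow>\<^sub>0 'k) \<Rightarrow> 'v \<Rightarrow> 'v" where
  "act f x = cls n f \<odot>\<^bsub>M\<^esub> x"

definition sc :: "'k \<Rightarrow> 'v \<Rightarrow> 'v" where
  "sc c x = B_scalar n c \<odot>\<^bsub>M\<^esub> x"

definition op :: "walk \<Rightarrow> 'v \<Rightarrow> 'v" where
  "op p x = (if p \<in> gen_paths n then act (Poly_Mapping.single p 1) x else \<zero>)"

lemma act_closed: "f \<in> carrier (path_algebra n) \<Longrightarrow> x \<in> carrier M \<Longrightarrow> act f x \<in> carrier M"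
  by (simp add: act_def smult_closed del: path_algebra_simps)

lemma act_add_left:
  assumes f: "f \<in> carrier (path_algebra n)" and g: "g \<in> carrier (path_algebra n)" and x: "x \<in> carrier M"
  shows "act (f + g) x = act f x \<oplus> act g x"
  using ring_hom_add[OF cls_hom f g] f g x by (simp add: act_def smult_l_distr)

lemma act_add_right:
  assumes f: "f \<in> carrier (path_algebra n)" and x: "x \<in> carrier M" "y \<in> carrier M"
  shows "act f (x \<oplus> y) = act f x \<oplus> act f y"
  using f x by (simp add: act_def smult_r_distr)

lemma act_mult:
  assumes f: "f \<in> carrier (path_algebra n)" and g: "g \<in> carrier (path_algebra n)" and x: "x \<in> carrier M"
  shows "act (path_mult f g) x = act f (act g x)"
  using ring_hom_mult[OF cls_hom f g] f g x by (simp add: act_def smult_assoc)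

lemma act_one: "x \<in> carrier M \<Longrightarrow> act (path_scalar n 1) x = x"
  using ring_hom_one[OF cls_hom] by (simp add: act_def smult_one)

lemma sc_act: "sc c = act (path_scalar n c)"
  by (simp add: sc_def act_def cls_scalar fun_eq_iff)

lemma scalar_carrier: "path_scalar n c \<in> carrier (path_algebra n)"
  using keys_path_scalar by simp

lemma single_carrier: "p \<in> paths n \<Longrightarrow> Poly_Mapping.single p c \<in> carrier (path_algebra n)"
  by simp

lemma gen_carrier: "p \<in> gen_paths n \<Longrightarrow> Poly_Mapping.single p c \<in> carrier (path_algebra n)"
  using gen_paths_subset by auto

sublocale ks: kspace M sc
proof (unfold_locales, goal_cases)
  case (1 x c)
  then show ?case using act_closed[OF scalar_carrier] by (simp add: sc_act)
next
  case (2 x c d)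
  then show ?case using act_add_left[OF scalar_carrier scalar_carrier] by (simp add: sc_act path_scalar_add)
next
  case (3 x y c)
  then show ?case using act_add_right[OF scalar_carrier] by (simp add: sc_act)
next
  case (4 x c d)
  then show ?case
    using act_mult[OF scalar_carrier scalar_carrier, of x c d]
    by (simp add: sc_act path_scalar_mult_scalar)
next
  case (5 x)
  then show ?case using act_one by (simp add: sc_act)
qed

lemma act_zero: "x \<in> carrier M \<Longrightarrow> act 0 x = \<zero>"
  using ks.sc_zero_left[of x] by (simp add: sc_act path_scalar_def)

lemma act_generator:
  assumes "g \<in> generators n" and x: "x \<in> carrier M"
  shows "act g x = \<zero>"
  using cls_generator[OF assms(1)] act_zero[OF x] ring_hom_zero[OF cls_hom ring_path_algebra R.ring_axioms]
  by (simp add: act_def)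

lemma act_zero_path: "p \<in> zero_paths n \<Longrightarrow> x \<in> carrier M \<Longrightarrow> act (Poly_Mapping.single p 1) x = \<zero>"
  by (rule act_generator) (unfold generators_def, blast)

lemma act_commuting_paths:
  assumes "(p, q) \<in> commuting_paths n" and x: "x \<in> carrier M"
  shows "act (Poly_Mapping.single p 1) x = act (Poly_Mapping.single q 1) x"
proof -
  let ?g = "Poly_Mapping.single p 1 - Poly_Mapping.single q (1::'k)"
  have g: "?g \<in> generators n" using assms(1) unfolding generators_def by blast
  then have gc: "?g \<in> carrier (path_algebra n)" using generators_closed[OF n] by blast
  have "q \<in> paths n"
    using assms by (auto simp: commuting_paths_def paths_def walks_def letters_def arrows_def)
  then have "act (?g + Poly_Mapping.single q 1) x = act ?g x \<oplus> act (Poly_Mapping.single q 1) x"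
    using act_add_left[OF gc single_carrier x] by blast
  moreover have "act ?g x = \<zero>" using act_generator[OF g x] .
  ultimately show ?thesis using act_closed[OF single_carrier[OF \<open>q \<in> paths n\<close>] x] by simp
qed

lemma op_endo: "ks.endo (op p)"
proof (cases "p \<in> gen_paths n")
  case True
  note p = gen_carrier[OF True, of 1]
  have "p \<in> paths n" using True gen_paths_subset by blast
  show ?thesis
    unfolding ks.endo_def
  proof (intro conjI ballI allI)
    show "op p ` carrier M \<subseteq> carrier M" using act_closed[OF p] by (auto simp: op_def)
    fix x assume x: "x \<in> carrier M"
    show "op p (x \<oplus> y) = op p x \<oplus> op p y" if "y \<in> carrier M" for y
      using act_add_right[OF p x that] True by (simp add: op_def)
    show "op p (sc c x) = sc c (op p x)" for c
      using act_mult[OF p scalar_carrier x, of c] act_mult[OF scalar_carrier p x, of c] True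
        path_scalar_single(1)[OF \<open>p \<in> paths n\<close>, of c 1] path_scalar_single(2)[OF \<open>p \<in> paths n\<close>, of 1 c]
      by (simp add: op_def sc_act)
  qed
qed (auto simp: ks.endo_def op_def)

lemma op_op:
  assumes x: "x \<in> carrier M"
  shows "op p (op q x) = (if p \<in> gen_paths n \<and> q \<in> gen_paths n \<and> walk_source p = walk_target q
    then act (Poly_Mapping.single (walk_append p q) 1) x else \<zero>)"
proof (cases "p \<in> gen_paths n \<and> q \<in> gen_paths n")
  case True
  then show ?thesis
    using act_mult[OF gen_carrier gen_carrier x, of p q 1 1] act_zero[OF x]
    by (cases "walk_source p = walk_target q") (simp_all add: op_def path_mult_single)
next
  case False
  then show ?thesis using ks.endo_zero[OF op_endo, of p] by (auto simp: op_def)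
qed

text \<open>
  The unit of the path algebra is the sum of the trivial paths.
\<close>

lemma op_complete:
  assumes x: "x \<in> carrier M" and zero: "\<And>i. op (i, []) x = \<zero>"
  shows "x = \<zero>"
proof -
  have "act (\<Sum>i\<in>J. Poly_Mapping.single (i, []) 1) x = \<zero>
      \<and> (\<Sum>i\<in>J. Poly_Mapping.single (i, []) (1::'k)) \<in> carrier (path_algebra n)"
    if "finite J" "J \<subseteq> {..n}" for J
    using that
  proof (induction J rule: finite_induct)
    case empty
    then show ?case using act_zero[OF x] by simp
  next
    case (insert i J)
    let ?s = "\<Sum>i\<in>J. Poly_Mapping.single (i, []) (1::'k)"
    have i: "(i, []) \<in> gen_paths n" and s: "?s \<in> carrier (path_algebra n)" "act ?s x = \<zero>"
      using insert by auto
    have "act (Poly_Mapping.single (i, []) 1) x = \<zero>" using zero[of i] i by (simp add: op_def)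
    then have "act (Poly_Mapping.single (i, []) 1 + ?s) x = \<zero>"
      using act_add_left[OF gen_carrier[OF i] s(1) x, of 1] s(2) by simp
    moreover have "Poly_Mapping.single (i, []) 1 + ?s \<in> carrier (path_algebra n)"
      using gen_carrier[OF i, of 1] s(1) Poly_Mapping.keys_add[of "Poly_Mapping.single (i, []) 1" ?s] by auto
    ultimately show ?case using insert by simp
  qed
  from this[of "{..n}"] have "act (path_scalar n 1) x = \<zero>" by (simp add: path_scalar_def)
  then show ?thesis using act_one[OF x] by simp
qed

lemma quiver_rep:
  assumes "finite_dimensional (B_scalar n) M"
  shows "quiver_rep M sc n (\<lambda>i. op (i, [])) (\<lambda>i. op (arrow_walk (Alpha i))) (\<lambda>i. op (arrow_walk (Beta i)))"
proof -
  interpret fd_kspace M sc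
  proof
    obtain X where X: "finite X" "X \<subseteq> carrier M"
      "\<forall>v \<in> carrier M. \<exists>c. v = (\<Oplus>x \<in> X. B_scalar n (c x) \<odot>\<^bsub>M\<^esub> x)"
      using assms unfolding finite_dimensional_def by (elim exE conjE)
    have "v \<in> U" if U: "ks.subsp U" "X \<subseteq> U" and v: "v \<in> carrier M" for U v
    proof -
      obtain c where "v = (\<Oplus>x \<in> X. sc (c x) x)" using X(3) v unfolding sc_def by blast
      moreover have "(\<Oplus>x \<in> X. sc (c x) x) \<in> U"
        using U ks.subspD(4)[OF U(1)] by (intro ks.subsp_finsum[OF U(1) X(1)]) auto
      ultimately show ?thesis by simp
    qed
    then show "\<exists>X. finite X \<and> X \<subseteq> carrier M \<and> (\<forall>U. ks.subsp U \<and> X \<subseteq> U \<longrightarrow> carrier M \<subseteq> U)"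
      using X(1,2) by (intro exI[of _ X]) blast
  qed
  have zp: "Suc i < n \<Longrightarrow> x \<in> carrier M \<Longrightarrow>
        act (Poly_Mapping.single (Suc (Suc i), [Dir (Alpha i), Dir (Alpha (Suc i))]) 1) x = \<zero>"
    "Suc i < n \<Longrightarrow> x \<in> carrier M \<Longrightarrow>
        act (Poly_Mapping.single (i, [Dir (Beta (Suc i)), Dir (Beta i)]) 1) x = \<zero>"
    "x \<in> carrier M \<Longrightarrow> act (Poly_Mapping.single (0, [Dir (Alpha 0), Dir (Beta 0)]) 1) x = \<zero>" for i x
    by (rule act_zero_path; simp add: zero_paths_def)+
  have cp: "Suc i < n \<Longrightarrow> x \<in> carrier M \<Longrightarrow>
        act (Poly_Mapping.single (Suc i, [Dir (Alpha (Suc i)), Dir (Beta (Suc i))]) 1) x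
      = act (Poly_Mapping.single (Suc i, [Dir (Beta i), Dir (Alpha i)]) 1) x" for i x
    by (rule act_commuting_paths[symmetric]) (simp_all add: commuting_paths_def)
  note walk = walk_source_def walk_target_def arrow_walk_def walk_append_def
  have op: "op (i, []) x = (if i \<le> n then act (Poly_Mapping.single (i, []) 1) x else \<zero>)"
    "op (Suc i, [Dir (Alpha i)]) x = (if i < n then act (Poly_Mapping.single (Suc i, [Dir (Alpha i)]) 1) x else \<zero>)"
    "op (i, [Dir (Beta i)]) x = (if i < n then act (Poly_Mapping.single (i, [Dir (Beta i)]) 1) x else \<zero>)" for i x
    using gen_paths_simps(2,3)[of i n] by (simp_all add: op_def arrow_walk_def)
  show ?thesis
  proof (unfold_locales, goal_cases)
    case (16 x)
    then show ?case using op_complete by blast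
  qed (simp_all add: op_op op_endo, (auto simp: op zp cp walk)?)
qed

lemma submodule_of_closed:
  assumes U: "ks.subsp U" and cl: "\<And>p. p \<in> gen_paths n \<Longrightarrow> op p ` U \<subseteq> U"
  shows "submodule U (B_algebra n) M"
proof (intro submodule.intro submodule_axioms.intro)
  show "subgroup U (add_monoid M)" using ks.subsp_subgroup[OF U] .
  fix b x assume "b \<in> carrier (B_algebra n :: (walk \<Rightarrow>\<^sub>0 'k) set ring)" "x \<in> U"
  then have "\<forall>x\<in>U. b \<odot>\<^bsub>M\<^esub> x \<in> U"
  proof (induction b rule: B_algebra_induct)
    case (scalar c)
    then show ?case using ks.subspD(4)[OF U] by (simp add: sc_def)
  next
    case (gen p)
    then show ?case using cl[OF gen(1)] by (auto simp: op_def act_def)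
  next
    case (add a b)
    then show ?case using ks.subspD(1,3)[OF U] by (auto simp: smult_l_distr)
  next
    case (mult a b)
    then show ?case using ks.subspD(1)[OF U] by (auto simp: smult_assoc)
  qed
  then show "b \<odot>\<^bsub>M\<^esub> x \<in> U" using \<open>x \<in> U\<close> by blast
qed

text \<open>
  The functionals of \<open>\<Phi>\<close> identify \<open>M\<close> with the space of functions on \<open>I\<close>, and a triple
  \<open>(p, i, j)\<close> in the table \<open>\<Sigma>\<close> says that the \<open>i\<close>-th coordinate of \<open>p \<cdot> m\<close> is the \<open>j\<close>-th
  coordinate of \<open>m\<close>; if the table has no entry starting with \<open>p, i\<close>, it is zero.
\<close>

definition coordinates :: "nat set \<Rightarrow> (walk \<times> nat \<times> nat) set \<Rightarrow> (nat \<Rightarrow> 'v \<Rightarrow> 'k) \<Rightarrow> bool" where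
  "coordinates I \<Sigma> \<Phi> \<longleftrightarrow> (\<forall>i\<in>I. ks.functional (\<Phi> i))
     \<and> (\<forall>c. \<exists>m\<in>carrier M. \<forall>i\<in>I. \<Phi> i m = c i)
     \<and> (\<forall>m\<in>carrier M. (\<forall>i\<in>I. \<Phi> i m = 0) \<longrightarrow> m = \<zero>)
     \<and> (\<forall>p i j. (p, i, j) \<in> \<Sigma> \<longrightarrow> j \<in> I \<and> (\<forall>m\<in>carrier M. \<Phi> i (op p m) = \<Phi> j m))
     \<and> (\<forall>p\<in>gen_paths n. \<forall>i\<in>I. (\<forall>j. (p, i, j) \<notin> \<Sigma>) \<longrightarrow> (\<forall>m\<in>carrier M. \<Phi> i (op p m) = 0))"

lemma coordinatesD:
  assumes "coordinates I \<Sigma> \<Phi>"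
  shows "i \<in> I \<Longrightarrow> ks.functional (\<Phi> i)"
    "\<exists>m\<in>carrier M. \<forall>i\<in>I. \<Phi> i m = c i"
    "m \<in> carrier M \<Longrightarrow> (\<And>i. i \<in> I \<Longrightarrow> \<Phi> i m = 0) \<Longrightarrow> m = \<zero>"
    "(p, i, j) \<in> \<Sigma> \<Longrightarrow> j \<in> I"
    "(p, i, j) \<in> \<Sigma> \<Longrightarrow> m \<in> carrier M \<Longrightarrow> \<Phi> i (op p m) = \<Phi> j m"
    "p \<in> gen_paths n \<Longrightarrow> i \<in> I \<Longrightarrow> \<forall>j. (p, i, j) \<notin> \<Sigma> \<Longrightarrow> m \<in> carrier M \<Longrightarrow> \<Phi> i (op p m) = 0"
  using assms unfolding coordinates_def by (simp_all del: split_paired_All)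

lemma coordinates_unique:
  assumes "coordinates I \<Sigma> \<Phi>" and m: "m \<in> carrier M" "m' \<in> carrier M"
    and eq: "\<And>i. i \<in> I \<Longrightarrow> \<Phi> i m = \<Phi> i m'"
  shows "m = m'"
proof (rule ks.eq_of_diff[OF m])
  have "\<Phi> i (m \<oplus> sc (-1) m') = 0" if "i \<in> I" for i
    using assms(1) m that eq[OF that] ks.functionalD[of "\<Phi> i"] unfolding coordinates_def by simp
  moreover have "m \<oplus> sc (-1) m' \<in> carrier M" using m by simp
  ultimately show "m \<oplus> sc (-1) m' = \<zero>" using assms(1) unfolding coordinates_def by blast
qed

lemma indecomposable_coordinates:
  assumes fd: "finite_dimensional (B_scalar n) M" and ind: "indecomposable (B_algebra n) M"
  shows "\<exists>I \<Sigma> \<Phi>. I \<subseteq> {..n + 3} \<and> \<Sigma> \<subseteq> gen_paths n \<times> {..n + 3} \<times> {..n + 3} \<and> coordinates I \<Sigma> \<Phi>"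
proof -
  interpret quiver_rep M sc n "\<lambda>i. op (i, [])" "\<lambda>i. op (arrow_walk (Alpha i))" "\<lambda>i. op (arrow_walk (Beta i))"
    by (rule quiver_rep[OF fd])
  have "carrier M \<noteq> {\<zero>}" using ind by (simp add: indecomposable_def)
  then obtain I X \<Phi> where I: "I \<subseteq> {..n + 3}" and ds: "dual_system ops I X \<Phi>"
    using dual_system_exists by blast
  have op_ops: "op p \<in> ops" if "p \<in> gen_paths n" for p
    using that unfolding gen_paths_def ops_def arrows_def by auto
  have "\<forall>f\<in>ops. ks.endo f" unfolding ops_def by (auto simp only: op_endo)
  note split = dual_system_splits[OF ds this]
  let ?W = "{m \<in> carrier M. \<forall>i\<in>I. \<Phi> i m = 0}"
  obtain S where S: "ks.subsp S" "ks.subsp ?W" "\<forall>f\<in>ops. f ` S \<subseteq> S \<and> f ` ?W \<subseteq> ?W"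
    "S \<inter> ?W = {\<zero>}" "S <+>\<^bsub>M\<^esub> ?W = carrier M" "S \<noteq> {\<zero>}"
    using split by (elim exE conjE)
  have "submodule S (B_algebra n) M"
    by (rule submodule_of_closed[OF S(1)]) (use S(3) op_ops in blast)
  moreover have "submodule ?W (B_algebra n) M"
    by (rule submodule_of_closed[OF S(2)]) (use S(3) op_ops in blast)
  ultimately have W: "?W = {\<zero>}" using ind S(4-6) unfolding indecomposable_def by blast
  define \<Sigma> where "\<Sigma> = {(p, i, j). p \<in> gen_paths n \<and> i \<in> I \<and> j \<in> I \<and> (\<forall>m\<in>carrier M. \<Phi> i (op p m) = \<Phi> j m)}"
  have "coordinates I \<Sigma> \<Phi>"
    unfolding coordinates_def
  proof (intro conjI)
    show "\<forall>i\<in>I. ks.functional (\<Phi> i)" using ds by (simp add: dual_system_def)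
    show "\<forall>c. \<exists>m\<in>carrier M. \<forall>i\<in>I. \<Phi> i m = c i" using dual_system_values[OF ds] by blast
    show "\<forall>m\<in>carrier M. (\<forall>i\<in>I. \<Phi> i m = 0) \<longrightarrow> m = \<zero>" using W by blast
    show "\<forall>p i j. (p, i, j) \<in> \<Sigma> \<longrightarrow> j \<in> I \<and> (\<forall>m\<in>carrier M. \<Phi> i (op p m) = \<Phi> j m)"
      by (auto simp: \<Sigma>_def)
    show "\<forall>p\<in>gen_paths n. \<forall>i\<in>I. (\<forall>j. (p, i, j) \<notin> \<Sigma>) \<longrightarrow> (\<forall>m\<in>carrier M. \<Phi> i (op p m) = 0)"
    proof (intro ballI impI)
      fix p i m assume p: "p \<in> gen_paths n" and i: "i \<in> I" and no: "\<forall>j. (p, i, j) \<notin> \<Sigma>" and m: "m \<in> carrier M"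
      have "(\<forall>v\<in>carrier M. \<Phi> i (op p v) = 0) \<or> (\<exists>j\<in>I. \<forall>v\<in>carrier M. \<Phi> i (op p v) = \<Phi> j v)"
        using ds op_ops[OF p] i unfolding dual_system_def by blast
      then show "\<Phi> i (op p m) = 0" using no p i m unfolding \<Sigma>_def by blast
    qed
  qed
  moreover have "\<Sigma> \<subseteq> gen_paths n \<times> {..n + 3} \<times> {..n + 3}" using I by (auto simp: \<Sigma>_def)
  ultimately show ?thesis using I by blast
qed

end

text \<open>
  The isomorphism matches vectors with equal coordinates. It commutes with the generators since
  in both modules these act on the coordinates through the same table.
\<close>

lemma isomorphic_of_coordinates:
  fixes M :: "((walk \<Rightarrow>\<^sub>0 'k::field) set, 'v) module" and N :: "((walk \<Rightarrow>\<^sub>0 'k) set, 'w) module"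
  assumes M: "B_module n M" and N: "B_module n N"
    and \<Phi>: "B_module.coordinates n M I \<Sigma> \<Phi>" and \<Psi>: "B_module.coordinates n N I \<Sigma> \<Psi>"
  shows "module_isomorphic (B_algebra n) M N"
proof -
  interpret M: B_module n M by (rule M)
  interpret N: B_module n N by (rule N)
  have functional: "M.ks.functional (\<Phi> i)" "N.ks.functional (\<Psi> i)" if "i \<in> I" for i
    using M.coordinatesD(1)[OF \<Phi> that] N.coordinatesD(1)[OF \<Psi> that] .
  have "\<forall>m. \<exists>y. m \<in> carrier M \<longrightarrow> y \<in> carrier N \<and> (\<forall>i\<in>I. \<Psi> i y = \<Phi> i m)"
    using N.coordinatesD(2)[OF \<Psi>] by meson
  then obtain f where f: "\<And>m. m \<in> carrier M \<Longrightarrow> f m \<in> carrier N"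
    "\<And>m i. m \<in> carrier M \<Longrightarrow> i \<in> I \<Longrightarrow> \<Psi> i (f m) = \<Phi> i m"
    by metis
  have f_eq: "f m = y" if "m \<in> carrier M" "y \<in> carrier N" "\<And>i. i \<in> I \<Longrightarrow> \<Psi> i y = \<Phi> i m" for m y
    using N.coordinates_unique[OF \<Psi> f(1)[OF that(1)] that(2)] that f(2) by simp
  have f_add: "f (x \<oplus>\<^bsub>M\<^esub> y) = f x \<oplus>\<^bsub>N\<^esub> f y" if "x \<in> carrier M" "y \<in> carrier M" for x y
    by (rule f_eq) (use that f M.ks.functionalD(1)[OF functional(1)]
        N.ks.functionalD(1)[OF functional(2)] in auto)
  have f_smult: "\<forall>x\<in>carrier M. f (b \<odot>\<^bsub>M\<^esub> x) = b \<odot>\<^bsub>N\<^esub> f x" if "b \<in> carrier (B_algebra n)" for b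
    using that
  proof (induction b rule: M.B_algebra_induct)
    case (scalar c)
    have "f (M.sc c x) = N.sc c (f x)" if "x \<in> carrier M" for x
      by (rule f_eq) (use that f M.ks.functionalD(2)[OF functional(1)]
          N.ks.functionalD(2)[OF functional(2)] in auto)
    then show ?case by (simp add: M.sc_def N.sc_def)
  next
    case (gen p)
    have "f (M.op p x) = N.op p (f x)" if x: "x \<in> carrier M" for x
    proof (rule f_eq)
      show "M.op p x \<in> carrier M" "N.op p (f x) \<in> carrier N"
        using M.ks.endoD(1)[OF M.op_endo] N.ks.endoD(1)[OF N.op_endo] x f(1) by auto
      fix i assume i: "i \<in> I"
      show "\<Psi> i (N.op p (f x)) = \<Phi> i (M.op p x)"
      proof (cases "\<exists>j. (p, i, j) \<in> \<Sigma>")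
        case True
        then obtain j where j: "(p, i, j) \<in> \<Sigma>" by blast
        have "j \<in> I" "\<Phi> i (M.op p x) = \<Phi> j x" "\<Psi> i (N.op p (f x)) = \<Psi> j (f x)"
          using M.coordinatesD(4)[OF \<Phi> j] M.coordinatesD(5)[OF \<Phi> j x]
            N.coordinatesD(5)[OF \<Psi> j f(1)[OF x]] .
        then show ?thesis using f(2)[OF x] by simp
      next
        case False
        then have "\<Phi> i (M.op p x) = 0" "\<Psi> i (N.op p (f x)) = 0"
          using M.coordinatesD(6)[OF \<Phi> gen i _ x] N.coordinatesD(6)[OF \<Psi> gen i _ f(1)[OF x]]
          by simp_all
        then show ?thesis by simp
      qed
    qed
    then show ?case using gen by (simp add: M.op_def N.op_def M.act_def N.act_def)
  next
    case (add a b)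
    then show ?case by (simp add: M.smult_l_distr N.smult_l_distr M.smult_closed f f_add)
  next
    case (mult a b)
    then show ?case by (simp add: M.smult_assoc N.smult_assoc M.smult_closed f)
  qed
  have "bij_betw f (carrier M) (carrier N)"
    unfolding bij_betw_def
  proof
    show "inj_on f (carrier M)"
    proof (rule inj_onI)
      fix x y assume "x \<in> carrier M" "y \<in> carrier M" "f x = f y"
      then show "x = y" using M.coordinates_unique[OF \<Phi>, of x y] f(2) by metis
    qed
    show "f ` carrier M = carrier N"
    proof
      show "carrier N \<subseteq> f ` carrier M"
      proof
        fix y assume y: "y \<in> carrier N"
        obtain x where "x \<in> carrier M" "\<And>i. i \<in> I \<Longrightarrow> \<Phi> i x = \<Psi> i y"
          using M.coordinatesD(2)[OF \<Phi>, of "\<lambda>i. \<Psi> i y"] by auto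
        then show "y \<in> f ` carrier M" using f_eq[of x y] y by force
      qed
    qed (use f in auto)
  qed
  then show ?thesis unfolding module_isomorphic_def using f_add f_smult by blast
qed

section \<open>Finitely many isomorphism classes\<close>

lemma finite_quotient:
  assumes r: "equiv A r" and T: "finite T" and type: "\<And>x. x \<in> A \<Longrightarrow> \<exists>t\<in>T. P x t"
    and eq: "\<And>x y t. x \<in> A \<Longrightarrow> y \<in> A \<Longrightarrow> P x t \<Longrightarrow> P y t \<Longrightarrow> (x, y) \<in> r"
  shows "finite (A // r)"
proof (rule finite_subset)
  show "finite ((\<lambda>t. r `` {SOME x. x \<in> A \<and> P x t}) ` T)" using T by simp
  show "A // r \<subseteq> (\<lambda>t. r `` {SOME x. x \<in> A \<and> P x t}) ` T"
  proof
    fix C assume "C \<in> A // r"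
    then obtain x where x: "x \<in> A" "C = r `` {x}" by (auto simp: quotient_def)
    obtain t where t: "t \<in> T" "P x t" using type[OF x(1)] by blast
    let ?y = "SOME x. x \<in> A \<and> P x t"
    have y: "?y \<in> A \<and> P ?y t" using someI[of "\<lambda>x. x \<in> A \<and> P x t"] x(1) t(2) by blast
    have "C = r `` {?y}"
      using equiv_class_eq[OF r eq[OF x(1) _ t(2)]] y x(2) by blast
    then show "C \<in> (\<lambda>t. r `` {SOME x. x \<in> A \<and> P x t}) ` T" using t(1) by blast
  qed
qed

lemma module_isomorphic_sym:
  assumes M: "left_module R M" and iso: "module_isomorphic R M N"
  shows "module_isomorphic R N M"
proof -
  interpret left_module R M by (rule M)
  obtain f where f: "bij_betw f (carrier M) (carrier N)"
    "\<And>x y. x \<in> carrier M \<Longrightarrow> y \<in> carrier M \<Longrightarrow> f (x \<oplus>\<^bsub>M\<^esub> y) = f x \<oplus>\<^bsub>N\<^esub> f y"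
    "\<And>a x. a \<in> carrier R \<Longrightarrow> x \<in> carrier M \<Longrightarrow> f (a \<odot>\<^bsub>M\<^esub> x) = a \<odot>\<^bsub>N\<^esub> f x"
    using iso unfolding module_isomorphic_def by blast
  let ?g = "inv_into (carrier M) f"
  have g: "?g y \<in> carrier M" "f (?g y) = y" if "y \<in> carrier N" for y
    using f(1) that by (auto simp: bij_betw_def inv_into_into f_inv_into_f)
  have gf: "?g (f x) = x" if "x \<in> carrier M" for x
    using f(1) that by (auto simp: bij_betw_def)
  have "?g (x \<oplus>\<^bsub>N\<^esub> y) = ?g x \<oplus>\<^bsub>M\<^esub> ?g y" if "x \<in> carrier N" "y \<in> carrier N" for x y
    using gf[of "?g x \<oplus>\<^bsub>M\<^esub> ?g y"] f(2)[of "?g x" "?g y"] g that by simp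
  moreover have "?g (a \<odot>\<^bsub>N\<^esub> x) = a \<odot>\<^bsub>M\<^esub> ?g x" if "a \<in> carrier R" "x \<in> carrier N" for a x
    using gf[of "a \<odot>\<^bsub>M\<^esub> ?g x"] f(3)[of a "?g x"] g that smult_closed by simp
  ultimately show ?thesis
    unfolding module_isomorphic_def using bij_betw_inv_into[OF f(1)] by blast
qed

lemma module_isomorphic_trans:
  assumes "module_isomorphic R M N" "module_isomorphic R N P"
  shows "module_isomorphic R M P"
proof -
  obtain f where f: "bij_betw f (carrier M) (carrier N)"
    "\<And>x y. x \<in> carrier M \<Longrightarrow> y \<in> carrier M \<Longrightarrow> f (x \<oplus>\<^bsub>M\<^esub> y) = f x \<oplus>\<^bsub>N\<^esub> f y"
    "\<And>a x. a \<in> carrier R \<Longrightarrow> x \<in> carrier M \<Longrightarrow> f (a \<odot>\<^bsub>M\<^esub> x) = a \<odot>\<^bsub>N\<^esub> f x"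
    using assms(1) unfolding module_isomorphic_def by blast
  obtain g where g: "bij_betw g (carrier N) (carrier P)"
    "\<And>x y. x \<in> carrier N \<Longrightarrow> y \<in> carrier N \<Longrightarrow> g (x \<oplus>\<^bsub>N\<^esub> y) = g x \<oplus>\<^bsub>P\<^esub> g y"
    "\<And>a x. a \<in> carrier R \<Longrightarrow> x \<in> carrier N \<Longrightarrow> g (a \<odot>\<^bsub>N\<^esub> x) = a \<odot>\<^bsub>P\<^esub> g x"
    using assms(2) unfolding module_isomorphic_def by blast
  have "f x \<in> carrier N" if "x \<in> carrier M" for x using f(1) that by (auto simp: bij_betw_def)
  then show ?thesis
    unfolding module_isomorphic_def using bij_betw_trans[OF f(1) g(1)] f(2,3) g(2,3)
    by (intro exI[of _ "g \<circ> f"]) auto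
qed

lemma equiv_module_isomorphic:
  fixes R :: "'b ring" and \<eta> :: "'k \<Rightarrow> 'b"
  shows "equiv (fd_indecomposables R \<eta> :: ('b, 'v) module set) {(M, N). M \<in> fd_indecomposables R \<eta> \<and> N \<in> fd_indecomposables R \<eta>
     \<and> module_isomorphic R M N}"
proof -
  have "module_isomorphic R M M" for M :: "('b, 'v) module"
    unfolding module_isomorphic_def by (intro exI[of _ id]) auto
  moreover have "left_module R M" if "M \<in> fd_indecomposables R \<eta>" for M :: "('b, 'v) module"
    using that by (simp add: fd_indecomposables_def)
  ultimately show ?thesis
    by (intro equivI) (auto simp: refl_on_def sym_def trans_def
        intro: module_isomorphic_sym module_isomorphic_trans)
qed

theorem mainTheorem1:
  fixes n :: nat
  assumes "n \<ge> 1"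
  shows "(\<nexists>w. is_band n w) \<and>
    representation_finite TYPE('v)
      (B_algebra n :: (walk \<Rightarrow>\<^sub>0 'k::alg_closed_field) set ring) (B_scalar n)"
proof
  show "\<nexists>w. is_band n w" using no_bands by blast
  let ?N = "{..n + 3}"
  let ?fd = "fd_indecomposables (B_algebra n :: (walk \<Rightarrow>\<^sub>0 'k) set ring) (B_scalar n)
    :: ((walk \<Rightarrow>\<^sub>0 'k) set, 'v) module set"
  let ?type = "\<lambda>M (I, \<Sigma>). \<exists>\<Phi>. B_module.coordinates n M I \<Sigma> \<Phi>"
  have B: "B_module n M" if "M \<in> ?fd" for M
    using that assms by (simp add: B_module_def fd_indecomposables_def)
  show "representation_finite TYPE('v) (B_algebra n :: (walk \<Rightarrow>\<^sub>0 'k) set ring) (B_scalar n)"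
    unfolding representation_finite_def
  proof (rule finite_quotient[OF equiv_module_isomorphic, where P = ?type])
    show "finite (Pow ?N \<times> Pow (gen_paths n \<times> ?N \<times> ?N))"
      using finite_gen_paths by simp
    show "\<exists>t\<in>Pow ?N \<times> Pow (gen_paths n \<times> ?N \<times> ?N). ?type M t" if "M \<in> ?fd" for M
      using B_module.indecomposable_coordinates[OF B[OF that]] that
      by (fastforce simp: fd_indecomposables_def)
    show "(M, N) \<in> {(M, N). M \<in> ?fd \<and> N \<in> ?fd \<and> module_isomorphic (B_algebra n) M N}"
      if "M \<in> ?fd" "N \<in> ?fd" "?type M t" "?type N t" for M N t
      using that isomorphic_of_coordinates[OF B[OF that(1)] B[OF that(2)]] by auto
  qed
qed

end
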